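(* Let $f_0=f_0(x,v)\ge0$ be $C^1$, compactly supported on $\mathbb{R}\times\mathbb{R}^2$ and not identically zero, and let $f(t,x,v)$ be the corresponding global solution of the monocharged relativistic Vlasov-Poisson system with $f(0,x,v)=f_0(x,v)$. Define $$Q_1(t)=\sup\{|v_1| : \text{there are } x,v_2\in\mathbb{R} \text{ such that } f(t,x,v_1,v_2)\ne0\}.$$ Then there are $T,C_1,C_2>0$ such that for all $t\ge T$, $$C_1t\le Q_1(t)\le C_2t.$$
   Context: The monocharged ``one and one-half dimensional'' relativistic Vlasov-Poisson system, for the unknown $f=f(t,x,v)\ge 0$ (particle number density), $t\ge 0$, $x\in\mathbb{R}$, $v=(v_1,v_2)\in\mathbb{R}^2$, is $$\partial_t f+\hat v_1\,\partial_x f+E_1\,\partial_{v_1}f=0,\qquad \rho(t,x)=\int_{\mathbb{R}^2} f(t,x,v)\,dv,$$ $$E_1(t,x)=\frac12\left(\int_{-\infty}^x\rho(t,y)\,dy-\int_x^\infty\rho(t,y)\,dy\right),$$ where $\hat v=v/\sqrt{1+|v|^2}$, so $\hat v_1=v_1/\sqrt{1+v_1^2+v_2^2}$. For initial data $f(0,x,v)=f_0(x,v)$ that are $C^1$, nonnegative and compactly supported, it is known that there is a solution that is $C^1$ for all $t\ge0$, with $f(t,\cdot,\cdot)$ compactly supported for each $t\geq 0$; solutions are understood in this sense. The constants $T,C_1,C_2$ may depend on $f_0$ but not on $t$. *)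

theory Defs
  imports "HOL-Analysis.Analysis"
begin

text \<open>
  Continuous differentiability relative to a set; at boundary points of \<open>S\<close> the derivative is the
  one relative to \<open>S\<close>. It is only used for sets that determine the derivative uniquely (the whole
  space, and a closed half-space).
\<close>

definition C1_on :: "'a::real_normed_vector set \<Rightarrow> ('a \<Rightarrow> 'b::real_normed_vector) \<Rightarrow> bool" where
  "C1_on S g \<longleftrightarrow> (\<exists>g' :: 'a \<Rightarrow> 'a \<Rightarrow>\<^sub>L 'b.
      (\<forall>z\<in>S. (g has_derivative blinfun_apply (g' z)) (at z within S)) \<and> continuous_on S g')"

definition compactly_supported :: "('a::topological_space \<Rightarrow> 'b::zero) \<Rightarrow> bool" where
  "compactly_supported g \<longleftrightarrow> compact (closure {z. g z \<noteq> 0})"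

text \<open>
  Densities are functions \<open>f t x v\<close> with \<open>v = (v\<^sub>1, v\<^sub>2)\<close>; the norm on \<open>real \<times> real\<close> is Euclidean.
\<close>

definition rel_velocity :: "real \<times> real \<Rightarrow> real \<times> real" where
  "rel_velocity v = v /\<^sub>R sqrt (1 + (norm v)\<^sup>2)"

definition charge_density :: "(real \<Rightarrow> real \<Rightarrow> real \<times> real \<Rightarrow> real) \<Rightarrow> real \<Rightarrow> real \<Rightarrow> real" where
  "charge_density f t x = (LINT v|lborel. f t x v)"

definition electric_field :: "(real \<Rightarrow> real \<Rightarrow> real \<times> real \<Rightarrow> real) \<Rightarrow> real \<Rightarrow> real \<Rightarrow> real" where
  "electric_field f t x =
     1/2 * ((LINT y:{..x}|lborel. charge_density f t y) - (LINT y:{x..}|lborel. charge_density f t y))"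

text \<open>
  Global classical solutions. Only the values of \<open>f\<close> at times \<open>t \<ge> 0\<close> matter; accordingly the
  time derivative is taken within \<open>{0..}\<close>, which makes it one-sided at \<open>t = 0\<close> and
  the usual derivative for \<open>t > 0\<close>.
\<close>

definition rvp_solution :: "(real \<Rightarrow> real \<Rightarrow> real \<times> real \<Rightarrow> real) \<Rightarrow> bool" where
  "rvp_solution f \<longleftrightarrow>
     C1_on ({0..} \<times> UNIV) (\<lambda>(t, x, v). f t x v) \<and>
     (\<forall>t\<ge>0. \<forall>x v. f t x v \<ge> 0) \<and>
     (\<forall>t\<ge>0. compactly_supported (\<lambda>(x, v). f t x v)) \<and>
     (\<forall>t\<ge>0. \<forall>x v1 v2.
        vector_derivative (\<lambda>s. f s x (v1, v2)) (at t within {0..})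
        + fst (rel_velocity (v1, v2)) * deriv (\<lambda>y. f t y (v1, v2)) x
        + electric_field f t x * deriv (\<lambda>w. f t x (w, v2)) v1 = 0)"

definition Q1 :: "(real \<Rightarrow> real \<Rightarrow> real \<times> real \<Rightarrow> real) \<Rightarrow> real \<Rightarrow> real" where
  "Q1 f t = Sup {\<bar>v1\<bar> | v1. \<exists>x v2. f t x (v1, v2) \<noteq> 0}"

end

theory Submission
  imports Defs
begin

text \<open>
  A maximum principle shows that, over a time interval with uniformly compact support, the support
  moves with speed at most \<open>1\<close> in \<open>x\<close>, at most \<open>M / 2\<close> in \<open>v\<^sub>1\<close> (where \<open>M\<close> is the total mass, as
  \<open>\<bar>E\<bar> \<le> M / 2\<close>) and not at all in \<open>v\<^sub>2\<close>; this gives the upper bound. For the lower bound let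
  \<open>\<phi> = v\<^sub>1 / sqrt (1 + v\<^sub>2\<^sup>2)\<close>, an increasing function of the relativistic velocity
  \<open>V\<^sub>1 = v\<^sub>1 / sqrt (1 + v\<^sub>1\<^sup>2 + v\<^sub>2\<^sup>2)\<close>, and let \<open>F\<close> be the integral of \<open>E \<phi> f\<close>. Since
  \<open>\<partial>\<^sub>x E = \<rho>\<close> and \<open>\<partial>\<^sub>t E = - j\<close>, with \<open>j\<close> the current, the derivative of \<open>F\<close> is the sum of
  \<open>\<integral> (\<rho> \<integral> \<phi> V\<^sub>1 f dv - j \<integral> \<phi> f dv) dx\<close>, which is nonnegative by Chebyshev's inequality, and of
  the integral of \<open>E\<^sup>2 (\<partial>\<phi>/\<partial>v\<^sub>1) f\<close>, which is at least a positive constant times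
  \<open>\<integral> E\<^sup>2 \<rho> dx = M\<^sup>3 / 12\<close>. So \<open>F\<close> grows linearly, while \<open>\<bar>F\<bar> \<le> M\<^sup>2 Q\<^sub>1 / 2\<close>.
\<close>

section \<open>One-sided maximum conditions and a maximum principle for the support\<close>

lemma continuous_on_compose_triple:
  fixes g :: "real \<Rightarrow> 'a::topological_space \<Rightarrow> 'b::topological_space \<Rightarrow> 'c::topological_space"
  assumes "continuous_on ({0..} \<times> UNIV) (\<lambda>(t, x, v). g t x v)"
    and "continuous_on A T" "continuous_on A X" "continuous_on A V" "\<And>z. z \<in> A \<Longrightarrow> 0 \<le> T z"
  shows "continuous_on A (\<lambda>z. g (T z) (X z) (V z))"
proof -
  have "continuous_on A (\<lambda>z. (T z, X z, V z))"
    using assms by (intro continuous_intros)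
  from continuous_on_compose2[OF assms(1) this] show ?thesis
    using assms(5) by auto
qed

text \<open>With a negative \<open>D\<close>, values just to the left of \<open>c\<close> would
  exceed \<open>g c\<close>; \<open>a < c\<close> puts them in the interval. Only this side is used,
  so \<open>c = b\<close> is allowed.\<close>

lemma has_real_derivative_max_right:
  fixes g :: "real \<Rightarrow> real"
  assumes "(g has_real_derivative D) (at c within {a..b})" "a < c" "c \<le> b"
    and "\<And>s. s \<in> {a..b} \<Longrightarrow> g s \<le> g c"
  shows "0 \<le> D"
proof (rule ccontr)
  assume "\<not> 0 \<le> D"
  then obtain d where d: "d > 0" "\<And>h. h > 0 \<Longrightarrow> c - h \<in> {a..b} \<Longrightarrow> h < d \<Longrightarrow> g c < g (c - h)"
    using has_real_derivative_neg_dec_left[OF assms(1)] by force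
  define h where "h = min (d/2) (c - a)"
  have "g c < g (c - h)" "g (c - h) \<le> g c"
    using assms d by (auto simp: h_def min_def intro!: d assms(4))
  then show False by simp
qed

lemma has_real_derivative_max_left:
  fixes g :: "real \<Rightarrow> real"
  assumes "(g has_real_derivative D) (at c within {a..b})" "a \<le> c" "c < b"
    and "\<And>s. s \<in> {a..b} \<Longrightarrow> g s \<le> g c"
  shows "D \<le> 0"
proof (rule ccontr)
  assume "\<not> D \<le> 0"
  then obtain d where d: "d > 0" "\<And>h. h > 0 \<Longrightarrow> c + h \<in> {a..b} \<Longrightarrow> h < d \<Longrightarrow> g c < g (c + h)"
    using has_real_derivative_pos_inc_right[OF assms(1)] by force
  define h where "h = min (d/2) (b - c)"
  have "g c < g (c + h)" "g (c + h) \<le> g c"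
    using assms d by (auto simp: h_def min_def intro!: d assms(4))
  then show False by simp
qed

text \<open>The partial derivatives are explicit, jointly continuous functions, ready for
  differentiation under integrals. \<open>fw\<close> is the derivative in the first momentum
  component; no force acts on the second.\<close>

locale rvp =
  fixes f ft fx fw :: "real \<Rightarrow> real \<Rightarrow> real \<times> real \<Rightarrow> real"
  assumes f_cont: "continuous_on ({0..} \<times> UNIV) (\<lambda>(t, x, v). f t x v)"
    and ft_cont: "continuous_on ({0..} \<times> UNIV) (\<lambda>(t, x, v). ft t x v)"
    and fx_cont: "continuous_on ({0..} \<times> UNIV) (\<lambda>(t, x, v). fx t x v)"
    and fw_cont: "continuous_on ({0..} \<times> UNIV) (\<lambda>(t, x, v). fw t x v)"
    and f_dt: "t \<ge> 0 \<Longrightarrow> ((\<lambda>s. f s x v) has_real_derivative ft t x v) (at t within {0..})"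
    and f_dx: "t \<ge> 0 \<Longrightarrow> ((\<lambda>y. f t y v) has_real_derivative fx t x v) (at x)"
    and f_dw: "t \<ge> 0 \<Longrightarrow> ((\<lambda>w. f t x (w, u)) has_real_derivative fw t x (w, u)) (at w)"
    and f_nonneg: "t \<ge> 0 \<Longrightarrow> 0 \<le> f t x v"
    and f_supp: "t \<ge> 0 \<Longrightarrow> compactly_supported (\<lambda>(x, v). f t x v)"
    and vlasov: "t \<ge> 0 \<Longrightarrow> ft t x v + fst (rel_velocity v) * fx t x v + electric_field f t x * fw t x v = 0"
begin

abbreviation "E \<equiv> electric_field f"
abbreviation "V1 v \<equiv> fst (rel_velocity v)"

lemmas f_comp = continuous_on_compose_triple[OF f_cont]
lemmas ft_comp = continuous_on_compose_triple[OF ft_cont]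
lemmas fx_comp = continuous_on_compose_triple[OF fx_cont]
lemmas fw_comp = continuous_on_compose_triple[OF fw_cont]

text \<open>The strict inequalities make \<open>f\<close> vanish on the boundary of the cube, which
  removes boundary terms in integrations by parts. Vanishing off an open cube is also a condition
  that survives limits in time.\<close>

definition confined :: "real \<Rightarrow> real set" where
  "confined L = {t. 0 \<le> t \<and> (\<forall>x v1 v2. f t x (v1, v2) \<noteq> 0 \<longrightarrow> \<bar>x\<bar> < L \<and> \<bar>v1\<bar> < L \<and> \<bar>v2\<bar> < L)}"

lemma confined_mono: "L \<le> L' \<Longrightarrow> confined L \<subseteq> confined L'"
  unfolding confined_def by force

lemma confined_nonneg: "t \<in> confined L \<Longrightarrow> 0 \<le> t"
  by (simp add: confined_def)

lemma confinedD: "t \<in> confined L \<Longrightarrow> f t x (v1, v2) \<noteq> 0 \<Longrightarrow> \<bar>x\<bar> < L \<and> \<bar>v1\<bar> < L \<and> \<bar>v2\<bar> < L"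
  unfolding confined_def by blast

lemma confinedI:
  "0 \<le> t \<Longrightarrow> (\<And>x v1 v2. f t x (v1, v2) \<noteq> 0 \<Longrightarrow> \<bar>x\<bar> < L \<and> \<bar>v1\<bar> < L \<and> \<bar>v2\<bar> < L) \<Longrightarrow> t \<in> confined L"
  unfolding confined_def by blast

text \<open>
  With \<open>\<sigma> = 1\<close> the support is followed forwards from \<open>c = a\<close>, with \<open>\<sigma> = -1\<close> backwards from \<open>c = b\<close>.
  If the claim failed, \<open>w = f * (\<alpha> x + \<beta> v\<^sub>1 + \<gamma> v\<^sub>2 - r - C \<bar>t - c\<bar>) - \<epsilon> \<bar>t - c\<bar>\<close> would
  have a positive maximum away from \<open>t = c\<close>, where the transport operator applied to \<open>w\<close> has the wrong sign.
\<close>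

lemma support_speed:
  fixes \<alpha> \<beta> \<gamma> r C \<sigma> :: real
  assumes ab: "a \<le> b" and conf: "{a..b} \<subseteq> confined L"
    and \<sigma>: "\<sigma> = 1 \<and> c = a \<or> \<sigma> = -1 \<and> c = b"
    and speed: "\<And>t x v. t \<in> {a..b} \<Longrightarrow> f t x v \<noteq> 0 \<Longrightarrow> \<bar>\<alpha> * V1 v + \<beta> * E t x\<bar> \<le> C"
    and init: "\<And>x v1 v2. f c x (v1, v2) \<noteq> 0 \<Longrightarrow> \<alpha> * x + \<beta> * v1 + \<gamma> * v2 \<le> r"
    and t: "t \<in> {a..b}" and ne: "f t x (v1, v2) \<noteq> 0"
  shows "\<alpha> * x + \<beta> * v1 + \<gamma> * v2 \<le> r + C * \<bar>t - c\<bar>"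
proof (rule ccontr)
  assume "\<not> ?thesis"
  then have gt: "\<alpha> * x + \<beta> * v1 + \<gamma> * v2 > r + C * \<bar>t - c\<bar>" by simp
  have a0: "0 \<le> a" using conf ab confined_nonneg by (meson atLeastAtMost_iff order_refl subsetD)
  have abs_eq: "\<bar>s - c\<bar> = \<sigma> * (s - c)" if "s \<in> {a..b}" for s
    using \<sigma> that by auto
  define w where "w = (\<lambda>\<epsilon> s y u1 u2. f s y (u1, u2) * (\<alpha> * y + \<beta> * u1 + \<gamma> * u2 - r - C * \<sigma> * (s - c)) - \<epsilon> * \<sigma> * (s - c))"
  have pos: "f t x (v1, v2) * (\<alpha> * x + \<beta> * v1 + \<gamma> * v2 - r - C * \<sigma> * (t - c)) > 0" (is "?p > 0")
    using gt ne f_nonneg[of t x "(v1,v2)"] t a0 abs_eq[OF t] by (auto intro!: mult_pos_pos simp: mult.assoc)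
  \<comment> \<open>The penalty then costs at most half of \<open>?p\<close>, so
    \<open>w \<epsilon>\<close> stays positive at the given point.\<close>
  define \<epsilon> where "\<epsilon> = ?p / (2 * (1 + b - a))"
  have \<epsilon>: "\<epsilon> > 0" using pos ab by (simp add: \<epsilon>_def)
  have "\<epsilon> * \<sigma> * (t - c) \<le> \<epsilon> * (1 + b - a)"
    using \<epsilon> t \<sigma> by (auto intro!: mult_left_mono)
  also have "\<dots> = ?p / 2"
    using ab by (simp add: \<epsilon>_def field_simps)
  finally have wpos: "w \<epsilon> t x v1 v2 > 0" unfolding w_def using pos by linarith
  define K where "K = {a..b} \<times> cbox (-L, -L, -L) (L, L, L)"
  have "compact K" unfolding K_def by (intro compact_Times) auto
  moreover have inK: "(t, x, v1, v2) \<in> K"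
    using confinedD[OF _ ne, of L] conf t by (force simp: K_def)
  moreover have "continuous_on K (\<lambda>(s, y, u1, u2). w \<epsilon> s y u1 u2)"
    unfolding w_def case_prod_unfold
    by (intro continuous_intros f_comp) (use a0 in \<open>auto simp: K_def\<close>)
  ultimately obtain m where m: "m \<in> K" "\<And>z. z \<in> K \<Longrightarrow> (\<lambda>(s, y, u1, u2). w \<epsilon> s y u1 u2) z \<le> (\<lambda>(s, y, u1, u2). w \<epsilon> s y u1 u2) m"
    using continuous_attains_sup[of K] by blast
  obtain s y u1 u2 where m_eq: "m = (s, y, u1, u2)" by (cases m) auto
  have s: "s \<in> {a..b}" using m m_eq by (auto simp: K_def)
  have mx: "w \<epsilon> t x v1 v2 \<le> w \<epsilon> s y u1 u2"
    using m(2)[OF inK] by (simp add: m_eq)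
  have wm: "w \<epsilon> s y u1 u2 > 0" using mx wpos by linarith
  \<comment> \<open>Off the support \<open>w \<epsilon>\<close> is at most zero, so the positive
    maximum over \<open>K\<close> is a maximum over all positions and momenta; it is therefore a
    critical point in x and in the first momentum component.\<close>
  have max: "w \<epsilon> s' y' u1' u2' \<le> w \<epsilon> s y u1 u2" if s': "s' \<in> {a..b}" for s' y' u1' u2'
  proof (cases "f s' y' (u1', u2') = 0")
    case True
    have "w \<epsilon> s' y' u1' u2' = - \<epsilon> * \<bar>s' - c\<bar>" using True abs_eq[OF s'] by (simp add: w_def)
    also have "\<dots> \<le> 0" using \<epsilon> by simp
    finally show ?thesis using wm by linarith
  next
    case False
    then have "(s', y', u1', u2') \<in> K"
      using confinedD[OF _ False, of L] conf s' by (force simp: K_def)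
    from m(2)[OF this] show ?thesis by (simp add: m_eq)
  qed
  define P where "P = \<alpha> * y + \<beta> * u1 + \<gamma> * u2 - r - C * \<sigma> * (s - c)"
  have s0: "0 \<le> s" using s a0 by auto
  have "0 \<le> \<epsilon> * \<sigma> * (s - c)" using \<epsilon> abs_eq[OF s] by (metis abs_ge_zero less_imp_le mult.assoc mult_nonneg_nonneg)
  then have fP: "f s y (u1, u2) * P > 0" using wm by (simp add: w_def P_def)
  then have P: "P > 0" and fpos: "f s y (u1, u2) > 0"
    using f_nonneg[OF s0, of y "(u1,u2)"] by (auto simp: zero_less_mult_iff)
  have "s \<noteq> c"
    using init[of y u1 u2] P fpos by (auto simp: P_def)
  let ?v = "(u1, u2)"
  have Dx: "fx s y ?v * P + f s y ?v * \<alpha> = 0"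
  proof (rule DERIV_local_max[where d = 1 and f = "\<lambda>y. w \<epsilon> s y u1 u2" and x = y])
    show "((\<lambda>y. w \<epsilon> s y u1 u2) has_real_derivative fx s y ?v * P + f s y ?v * \<alpha>) (at y)"
      unfolding w_def P_def by (rule derivative_eq_intros f_dx s0 refl | simp)+
  qed (use max s in auto)
  have Dw: "fw s y ?v * P + f s y ?v * \<beta> = 0"
  proof (rule DERIV_local_max[where d = 1 and f = "\<lambda>u1. w \<epsilon> s y u1 u2" and x = u1])
    show "((\<lambda>u1. w \<epsilon> s y u1 u2) has_real_derivative fw s y ?v * P + f s y ?v * \<beta>) (at u1)"
      unfolding w_def P_def by (rule derivative_eq_intros f_dw s0 refl | simp)+
  qed (use max s in auto)
  define Dt where "Dt = ft s y ?v * P - f s y ?v * C * \<sigma> - \<epsilon> * \<sigma>"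
  have f_dt': "((\<lambda>s. f s y ?v) has_real_derivative ft s y ?v) (at s within {a..b})"
    by (rule DERIV_subset[OF f_dt]) (use s0 a0 in auto)
  have der: "((\<lambda>s. w \<epsilon> s y u1 u2) has_real_derivative Dt) (at s within {a..b})"
    unfolding w_def P_def Dt_def by (rule derivative_eq_intros f_dt' refl | simp add: algebra_simps)+
  have "0 \<le> \<sigma> * Dt"
  proof (cases "\<sigma> = 1")
    case True
    have "0 \<le> Dt" by (rule has_real_derivative_max_right[OF der]) (use True \<sigma> \<open>s \<noteq> c\<close> s max in auto)
    then show ?thesis using True by simp
  next
    case False
    have "Dt \<le> 0" by (rule has_real_derivative_max_left[OF der]) (use False \<sigma> \<open>s \<noteq> c\<close> s max in auto)
    then show ?thesis using False \<sigma> by simp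
  qed
  \<comment> \<open>The Vlasov equation trades \<open>ft\<close> for \<open>fx\<close> and
    \<open>fw\<close>, and the critical point conditions trade those for \<open>f\<close> itself,
    leaving only the speed along the support.\<close>
  moreover have "\<sigma> * Dt = f s y ?v * (\<sigma> * (\<alpha> * V1 ?v + \<beta> * E s y) - C) - \<epsilon>"
  proof -
    have "ft s y ?v * P = - V1 ?v * (fx s y ?v * P) - E s y * (fw s y ?v * P)"
      using vlasov[OF s0, of y ?v] by algebra
    also have "\<dots> = f s y ?v * (\<alpha> * V1 ?v + \<beta> * E s y)"
      using Dx Dw by algebra
    finally have "Dt = f s y ?v * (\<alpha> * V1 ?v + \<beta> * E s y) - f s y ?v * C * \<sigma> - \<epsilon> * \<sigma>"
      by (simp add: Dt_def)
    moreover have "\<sigma> * \<sigma> = 1" using \<sigma> by auto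
    ultimately show ?thesis by algebra
  qed
  moreover have "\<sigma> * (\<alpha> * V1 ?v + \<beta> * E s y) \<le> \<bar>\<alpha> * V1 ?v + \<beta> * E s y\<bar>"
    using \<sigma> by auto
  then have "f s y ?v * (\<sigma> * (\<alpha> * V1 ?v + \<beta> * E s y) - C) \<le> 0"
    using speed[OF s, of y ?v] fpos by (intro mult_nonneg_nonpos) auto
  ultimately show False using \<epsilon> by linarith
qed

end

subsection \<open>Velocity moments and the electric field\<close>

text \<open>The system is stated with Lebesgue integrals over unbounded sets. Confinement reduces
  them to integrals over a box, where the fundamental theorem of calculus and differentiation under
  the integral are at hand.\<close>

lemma set_lebesgue_integral_cbox:
  fixes g :: "'a::euclidean_space \<Rightarrow> real"
  assumes "continuous_on (cbox a b) g" and "\<And>x. x \<in> S \<Longrightarrow> g x \<noteq> 0 \<Longrightarrow> x \<in> cbox a b"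
    and "cbox a b \<subseteq> S"
  shows "(LINT x:S|lborel. g x) = integral (cbox a b) g"
proof -
  have "(LINT x:S|lborel. g x) = (LINT x:cbox a b|lborel. g x)"
    unfolding set_lebesgue_integral_def
    by (rule Bochner_Integration.integral_cong) (use assms in \<open>auto simp: indicator_def\<close>)
  also have "\<dots> = integral (cbox a b) g"
    by (intro set_borel_integral_eq_integral)
      (use borel_integrable_compact[OF compact_cbox assms(1)] in \<open>simp add: set_integrable_def\<close>)
  finally show ?thesis .
qed

lemma has_field_derivative_eq_on:
  assumes "(f has_field_derivative D) (at x within S)" "x \<in> S" "\<And>y. y \<in> S \<Longrightarrow> g y = f y"
  shows "(g has_field_derivative D) (at x within S)"
  using assms has_derivative_transform[of x S g f] unfolding has_field_derivative_def by blast

lemma rel_velocity_fst: "fst (rel_velocity v) = fst v / sqrt (1 + (norm v)\<^sup>2)"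
  by (simp add: rel_velocity_def divide_inverse mult.commute)

lemma continuous_on_rel_velocity: "continuous_on A (\<lambda>v. fst (rel_velocity v))"
  unfolding rel_velocity_fst
  by (intro continuous_intros) (auto simp: add_nonneg_eq_0_iff)

context rvp
begin

text \<open>The cut-off at the cube of size \<open>L\<close> gives moments that are continuous and
  differentiable at all times \<open>t \<ge> 0\<close>, whether or not the support fits; on
  \<open>confined L\<close> nothing is lost.\<close>

definition mom :: "real \<Rightarrow> (real \<times> real \<Rightarrow> real) \<Rightarrow> real \<Rightarrow> real \<Rightarrow> real" where
  "mom L w t x = integral (cbox (-L, -L) (L, L)) (\<lambda>v. w v * f t x v)"

definition momx :: "real \<Rightarrow> (real \<times> real \<Rightarrow> real) \<Rightarrow> real \<Rightarrow> real \<Rightarrow> real" where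
  "momx L w t x = integral (cbox (-L, -L) (L, L)) (\<lambda>v. w v * fx t x v)"

definition momt :: "real \<Rightarrow> (real \<times> real \<Rightarrow> real) \<Rightarrow> real \<Rightarrow> real \<Rightarrow> real" where
  "momt L w t x = integral (cbox (-L, -L) (L, L)) (\<lambda>v. w v * ft t x v)"

lemma continuous_on_integral_weighted:
  assumes g: "continuous_on ({0..} \<times> UNIV) (\<lambda>(t, x, v). (g :: real \<Rightarrow> real \<Rightarrow> real \<times> real \<Rightarrow> real) t x v)"
    and w: "continuous_on UNIV w"
    and "continuous_on A T" "continuous_on A X" "\<And>z. z \<in> A \<Longrightarrow> 0 \<le> T z"
  shows "continuous_on A (\<lambda>z. integral (cbox (-L, -L) (L, L)) (\<lambda>v. w v * g (T z) (X z) v))"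
proof (rule integral_continuous_on_param)
  show "continuous_on (A \<times> cbox (-L, -L) (L, L)) (\<lambda>(z, v). w v * g (T z) (X z) v)"
    unfolding case_prod_unfold
    by (intro continuous_intros continuous_on_compose_triple[OF g] continuous_on_compose2[OF w]
        continuous_on_compose2[OF assms(3)] continuous_on_compose2[OF assms(4)])
      (use assms(5) in auto)
qed

lemma mom_comp:
  assumes "continuous_on UNIV w" "continuous_on A T" "continuous_on A X" "\<And>z. z \<in> A \<Longrightarrow> 0 \<le> T z"
  shows "continuous_on A (\<lambda>z. mom L w (T z) (X z))"
  unfolding mom_def by (rule continuous_on_integral_weighted[OF f_cont assms])

lemma momx_comp:
  assumes "continuous_on UNIV w" "continuous_on A T" "continuous_on A X" "\<And>z. z \<in> A \<Longrightarrow> 0 \<le> T z"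
  shows "continuous_on A (\<lambda>z. momx L w (T z) (X z))"
  unfolding momx_def by (rule continuous_on_integral_weighted[OF fx_cont assms])

lemma momt_comp:
  assumes "continuous_on UNIV w" "continuous_on A T" "continuous_on A X" "\<And>z. z \<in> A \<Longrightarrow> 0 \<le> T z"
  shows "continuous_on A (\<lambda>z. momt L w (T z) (X z))"
  unfolding momt_def by (rule continuous_on_integral_weighted[OF ft_cont assms])

lemma integrable_weighted:
  assumes w: "continuous_on UNIV w" and t: "0 \<le> t"
  shows "(\<lambda>v. w v * f t x v) integrable_on cbox a b"
    and "(\<lambda>v. w v * fx t x v) integrable_on cbox a b"
    and "(\<lambda>v. w v * ft t x v) integrable_on cbox a b"
    and "(\<lambda>v. w v * fw t x v) integrable_on cbox a b"
  by (intro integrable_continuous continuous_intros f_comp fx_comp ft_comp fw_comp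
      continuous_on_subset[OF w]; use t in auto)+

lemma mom_dx:
  assumes w: "continuous_on UNIV w" and t: "0 \<le> t"
  shows "((\<lambda>x. mom L w t x) has_real_derivative momx L w t x) (at x)"
  unfolding mom_def momx_def
proof (rule leibniz_rule_field_derivative[where U = UNIV, simplified])
  show "continuous_on (UNIV \<times> cbox (-L, -L) (L, L)) (\<lambda>(x, v). w v * fx t x v)"
    unfolding case_prod_unfold
    by (intro continuous_intros fx_comp continuous_on_compose2[OF w]) (use t in auto)
  show "((\<lambda>x. w v * f t x v) has_real_derivative w v * fx t x v) (at x)" for x v
    by (rule derivative_eq_intros f_dx t refl | simp)+
qed (use integrable_weighted[OF w t] in auto)

lemma mom_dt:
  assumes w: "continuous_on UNIV w" and t: "0 \<le> t"
  shows "((\<lambda>t. mom L w t x) has_real_derivative momt L w t x) (at t within {0..})"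
  unfolding mom_def momt_def
proof (rule leibniz_rule_field_derivative)
  show "continuous_on ({0..} \<times> cbox (-L, -L) (L, L)) (\<lambda>(t, v). w v * ft t x v)"
    unfolding case_prod_unfold
    by (intro continuous_intros ft_comp continuous_on_compose2[OF w]) auto
  show "((\<lambda>s. w v * f s x v) has_real_derivative w v * ft s x v) (at s within {0..})" if "s \<in> {0..}" for s v
    using that by (auto intro!: derivative_eq_intros f_dt)
qed (use integrable_weighted(1)[OF w] t in auto)

text \<open>The force term is integrated by parts in \<open>v\<^sub>1\<close>; the field does not depend on \<open>v\<close>.\<close>

lemma mom_balance:
  assumes t: "t \<in> confined L" and L: "0 < L"
    and w: "continuous_on UNIV w" and w': "continuous_on UNIV w'"
    and dw: "\<And>v1 v2. ((\<lambda>v1. w (v1, v2)) has_real_derivative w' (v1, v2)) (at v1)"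
  shows "momt L w t x = - momx L (\<lambda>v. w v * V1 v) t x + E t x * mom L w' t x"
proof -
  let ?B = "cbox (-L, -L) (L, L)"
  have t0: "0 \<le> t" using t by (rule confined_nonneg)
  have wV: "continuous_on UNIV (\<lambda>v. w v * V1 v)"
    by (intro continuous_intros w continuous_on_rel_velocity)
  note int = integrable_weighted[OF w t0] integrable_weighted[OF w' t0] integrable_weighted[OF wV t0]
  have "integral ?B (\<lambda>v. w v * fw t x v + w' v * f t x v)
      = integral {-L..L} (\<lambda>u1. integral {-L..L} (\<lambda>u2. w (u1, u2) * fw t x (u1, u2) + w' (u1, u2) * f t x (u1, u2)))"
    by (subst integral_prod_continuous, intro continuous_intros fw_comp f_comp
      continuous_on_subset[OF w] continuous_on_subset[OF w']) (use t0 in auto)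
  also have "\<dots> = integral {-L..L} (\<lambda>u2. integral {-L..L} (\<lambda>u1. w (u1, u2) * fw t x (u1, u2) + w' (u1, u2) * f t x (u1, u2)))"
    unfolding cbox_interval[symmetric]
    by (rule integral_swap_continuous, unfold case_prod_unfold prod.collapse, intro continuous_intros fw_comp f_comp
      continuous_on_subset[OF w] continuous_on_subset[OF w']) (use t0 in auto)
  also have "\<dots> = integral {-L..L} (\<lambda>u2. 0)"
  proof (rule integral_cong)
    fix u2
    have "((\<lambda>u1. w (u1, u2) * fw t x (u1, u2) + w' (u1, u2) * f t x (u1, u2)) has_integral
        w (L, u2) * f t x (L, u2) - w (-L, u2) * f t x (-L, u2)) {-L..L}"
    proof (rule fundamental_theorem_of_calculus)
      show "((\<lambda>u1. w (u1, u2) * f t x (u1, u2)) has_vector_derivative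
          w (u1, u2) * fw t x (u1, u2) + w' (u1, u2) * f t x (u1, u2)) (at u1 within {-L..L})" for u1
        unfolding has_real_derivative_iff_has_vector_derivative[symmetric]
        by (rule has_field_derivative_at_within) (auto intro!: derivative_eq_intros dw f_dw t0)
    qed (use L in auto)
    moreover have "f t x (L, u2) = 0" "f t x (-L, u2) = 0"
      using confinedD[OF t] by force+
    ultimately show "integral {-L..L} (\<lambda>u1. w (u1, u2) * fw t x (u1, u2) + w' (u1, u2) * f t x (u1, u2)) = 0"
      by (simp add: integral_unique)
  qed
  finally have parts: "integral ?B (\<lambda>v. w v * fw t x v) = - mom L w' t x"
    by (simp add: mom_def integral_add int)
  have "momt L w t x = integral ?B (\<lambda>v. - (w v * V1 v * fx t x v) - E t x * (w v * fw t x v))"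
    unfolding momt_def
  proof (rule integral_cong)
    fix v
    show "w v * ft t x v = - (w v * V1 v * fx t x v) - E t x * (w v * fw t x v)"
      using vlasov[OF t0, of x v] by algebra
  qed
  also have "\<dots> = - momx L (\<lambda>v. w v * V1 v) t x - E t x * integral ?B (\<lambda>v. w v * fw t x v)"
    by (subst Henstock_Kurzweil_Integration.integral_diff)
      (auto intro!: integrable_neg integrable_on_mult_right int simp: momx_def)
  finally show ?thesis by (simp add: parts)
qed

definition rho :: "real \<Rightarrow> real \<Rightarrow> real" where
  "rho t x = charge_density f t x"

definition mass :: "real \<Rightarrow> real" where
  "mass t = (LINT x|lborel. rho t x)"

lemma rho_mom:
  assumes t: "t \<in> confined L"
  shows "rho t x = mom L (\<lambda>_. 1) t x"
proof -
  have t0: "0 \<le> t" using t by (rule confined_nonneg)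
  have "(LINT v:UNIV|lborel. f t x v) = integral (cbox (-L, -L) (L, L)) (f t x)"
  proof (rule set_lebesgue_integral_cbox)
    show "continuous_on (cbox (-L, -L) (L, L)) (f t x)"
      by (intro f_comp continuous_intros) (use t0 in auto)
    fix v assume "f t x v \<noteq> 0"
    then show "v \<in> cbox (-L, -L) (L, L)"
      using confinedD[OF t, of x "fst v" "snd v"] by (cases v) auto
  qed auto
  then show ?thesis
    by (simp add: rho_def charge_density_def mom_def set_lebesgue_integral_def)
qed

lemma confined_ex: assumes "0 \<le> t" obtains L where "t \<in> confined L" "0 < L"
proof -
  have "bounded {z. (\<lambda>(x, v). f t x v) z \<noteq> 0}"
    using f_supp[OF assms] unfolding compactly_supported_def
    by (meson bounded_subset closure_subset compact_imp_bounded)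
  then obtain B where B: "\<And>z. (\<lambda>(x, v). f t x v) z \<noteq> 0 \<Longrightarrow> norm z \<le> B"
    unfolding bounded_iff by blast
  have "t \<in> confined (max B 0 + 1)"
  proof (rule confinedI[OF assms])
    fix x v1 v2 assume "f t x (v1, v2) \<noteq> 0"
    then have "norm (x, v1, v2) \<le> B" using B[of "(x, v1, v2)"] by simp
    moreover have "\<bar>x\<bar> \<le> norm (x, v1, v2)" "norm (v1, v2) \<le> norm (x, v1, v2)"
      "\<bar>v1\<bar> \<le> norm (v1, v2)" "\<bar>v2\<bar> \<le> norm (v1, v2)"
      using norm_fst_le[of x "(v1, v2)"] norm_snd_le[of "(v1, v2)" x] norm_fst_le[of v1 v2] norm_snd_le[of v2 v1]
      by auto
    ultimately show "\<bar>x\<bar> < max B 0 + 1 \<and> \<bar>v1\<bar> < max B 0 + 1 \<and> \<bar>v2\<bar> < max B 0 + 1" by linarith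
  qed
  then show thesis by (rule that) simp
qed

lemma rho_cont:
  assumes "0 \<le> t"
  shows "continuous_on A (rho t)"
proof -
  from assms obtain L where L: "t \<in> confined L" by (rule confined_ex)
  have "continuous_on A (\<lambda>x. mom L (\<lambda>_. 1) t x)"
    by (intro mom_comp continuous_intros) (use assms in auto)
  then show ?thesis by (simp add: rho_mom[OF L])
qed

lemma rho_nonneg: "0 \<le> t \<Longrightarrow> 0 \<le> rho t x"
  unfolding rho_def charge_density_def by (simp add: f_nonneg)

lemma rho_supp: assumes "t \<in> confined L" "rho t x \<noteq> 0" shows "\<bar>x\<bar> < L"
proof (rule ccontr)
  assume "\<not> \<bar>x\<bar> < L"
  then have "f t x v = 0" for v
    using confinedD[OF assms(1), of x "fst v" "snd v"] by auto
  then show False using assms(2) by (simp add: rho_def charge_density_def)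
qed

lemma mass_eq: assumes t: "t \<in> confined L" shows "mass t = integral {-L..L} (rho t)"
proof -
  have t0: "0 \<le> t" using t by (rule confined_nonneg)
  have "(LINT x:UNIV|lborel. rho t x) = integral (cbox (-L) L) (rho t)"
    by (rule set_lebesgue_integral_cbox) (use rho_supp[OF t] rho_cont[OF t0] in force)+
  then show ?thesis by (simp add: mass_def set_lebesgue_integral_def)
qed

lemma E_eq:
  assumes t: "t \<in> confined L" and x: "\<bar>x\<bar> \<le> L"
  shows "E t x = 1/2 * (integral {-L..x} (rho t) - integral {x..L} (rho t))"
proof -
  have t0: "0 \<le> t" using t by (rule confined_nonneg)
  have eq: "(LINT y:S|lborel. rho t y) = integral {c..d} (rho t)"
    if "\<And>y. y \<in> S \<Longrightarrow> \<bar>y\<bar> < L \<Longrightarrow> y \<in> {c..d}" "{c..d} \<subseteq> S" for S c d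
    unfolding cbox_interval[symmetric]
    by (rule set_lebesgue_integral_cbox) (use rho_supp[OF t] rho_cont[OF t0] that in auto)
  have "(LINT y:{..x}|lborel. rho t y) = integral {-L..x} (rho t)"
    "(LINT y:{x..}|lborel. rho t y) = integral {x..L} (rho t)"
    by (rule eq; force)+
  then show ?thesis by (simp add: electric_field_def rho_def)
qed

lemma E_eq_mass:
  assumes t: "t \<in> confined L" and x: "\<bar>x\<bar> \<le> L"
  shows "E t x = integral {-L..x} (rho t) - mass t / 2"
proof -
  have "integral {-L..L} (rho t) = integral {-L..x} (rho t) + integral {x..L} (rho t)"
    by (rule Henstock_Kurzweil_Integration.integral_combine[symmetric])
      (use x rho_cont[OF confined_nonneg[OF t]] in \<open>auto intro: integrable_continuous_real\<close>)
  then show ?thesis using E_eq[OF t x] mass_eq[OF t] by (simp add: field_simps)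
qed

lemma mass_nonneg: "0 \<le> t \<Longrightarrow> 0 \<le> mass t"
  unfolding mass_def by (simp add: rho_nonneg)

text \<open>The charge to the left runs between zero and the total mass, and subtracting half the
  mass centres this range.\<close>

lemma E_bound:
  assumes t: "t \<in> confined L" and x: "\<bar>x\<bar> \<le> L"
  shows "\<bar>E t x\<bar> \<le> mass t / 2"
proof -
  have t0: "0 \<le> t" using t by (rule confined_nonneg)
  have "0 \<le> integral {-L..x} (rho t)"
    by (intro Henstock_Kurzweil_Integration.integral_nonneg integrable_continuous_real rho_cont t0 rho_nonneg)
  moreover have "integral {-L..x} (rho t) \<le> integral {-L..L} (rho t)"
    by (rule integral_subset_le)
      (use x rho_cont t0 rho_nonneg in \<open>auto intro: integrable_continuous_real\<close>)
  ultimately show ?thesis using E_eq_mass[OF assms] mass_eq[OF t] unfolding abs_le_iff by linarith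
qed

lemma E_bound_support:
  assumes "0 \<le> t" "f t x v \<noteq> 0"
  shows "\<bar>E t x\<bar> \<le> mass t / 2"
proof -
  obtain L where L: "t \<in> confined L" by (rule confined_ex[OF assms(1)])
  have "\<bar>x\<bar> < L" using confinedD[OF L, of x "fst v" "snd v"] assms by auto
  then show ?thesis using E_bound[OF L] by auto
qed

lemma momx_integral:
  assumes t: "t \<in> confined L" and w: "continuous_on UNIV w" and xy: "x \<le> y"
  shows "integral {x..y} (momx L w t) = mom L w t y - mom L w t x"
proof -
  have "(momx L w t has_integral mom L w t y - mom L w t x) {x..y}"
    by (rule fundamental_theorem_of_calculus[OF xy])
      (auto simp flip: has_real_derivative_iff_has_vector_derivative
        intro: has_field_derivative_at_within mom_dx w confined_nonneg[OF t])
  then show ?thesis by (rule integral_unique)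
qed

lemma mom_outside:
  assumes t: "t \<in> confined L" and "L \<le> \<bar>x\<bar>"
  shows "mom L w t x = 0"
proof -
  have "f t x v = 0" for v
    using confinedD[OF t, of x "fst v" "snd v"] assms(2) by auto
  then show ?thesis by (simp add: mom_def)
qed

section \<open>Continuity equation, derivatives of the field and conservation of mass\<close>

abbreviation "J L t x \<equiv> mom L V1 t x"

text \<open>The constant weight has derivative zero, so the force term drops out of the moment
  balance.\<close>

lemma continuity_equation:
  assumes t: "t \<in> confined L" and L: "0 < L"
  shows "momt L (\<lambda>_. 1) t x = - momx L V1 t x"
  using mom_balance[OF assms, of "\<lambda>_. 1" "\<lambda>_. 0"] by (simp add: mom_def)

text \<open>Differentiation under the integral and the continuity equation leave an exact
  x-derivative, which integrates to the difference of the fluxes at the two ends.\<close>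

lemma integral_rho_dt:
  assumes conf: "{a..b} \<subseteq> confined L" and L: "0 < L" and t: "t \<in> {a..b}" and xy: "x \<le> y"
  shows "((\<lambda>s. integral {x..y} (rho s)) has_real_derivative J L t x - J L t y) (at t within {a..b})"
proof -
  have tc: "s \<in> confined L" if "s \<in> {a..b}" for s using conf that by auto
  have nn: "s \<ge> 0" if "s \<in> {a..b}" for s using tc[OF that] confined_nonneg by auto
  have "((\<lambda>s. integral (cbox x y) (mom L (\<lambda>_. 1) s)) has_real_derivative integral (cbox x y) (momt L (\<lambda>_. 1) t))
    (at t within {a..b})"
  proof (rule leibniz_rule_field_derivative)
    show "continuous_on ({a..b} \<times> cbox x y) (\<lambda>(s, y). momt L (\<lambda>_. 1) s y)"
      unfolding case_prod_unfold by (intro momt_comp continuous_intros) (use nn in auto)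
    show "((\<lambda>s. mom L (\<lambda>_. 1) s y) has_real_derivative momt L (\<lambda>_. 1) s y) (at s within {a..b})" if "s \<in> {a..b}" for s y
      by (rule DERIV_subset[OF mom_dt]) (use nn that in auto)
    show "mom L (\<lambda>_. 1) s integrable_on cbox x y" if "s \<in> {a..b}" for s
      by (intro integrable_continuous mom_comp continuous_intros) (use nn that in auto)
  qed (use t in auto)
  also have "integral (cbox x y) (momt L (\<lambda>_. 1) t) = J L t x - J L t y"
    using momx_integral[OF tc[OF t] continuous_on_rel_velocity xy]
    by (simp add: continuity_equation[OF tc[OF t] L, abs_def])
  finally have "((\<lambda>s. integral {x..y} (mom L (\<lambda>_. 1) s)) has_real_derivative J L t x - J L t y) (at t within {a..b})"
    by simp
  then show ?thesis
    by (rule has_field_derivative_eq_on) (use tc t in \<open>auto simp: rho_mom intro!: integral_cong\<close>)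
qed

text \<open>The fluxes at \<open>-L\<close> and \<open>L\<close> vanish by confinement. The flux
  through \<open>x\<close> leaves the left charge and enters the right charge, which cancels the
  factor 1/2.\<close>

lemma E_dt:
  assumes conf: "{a..b} \<subseteq> confined L" and L: "0 < L" and t: "t \<in> {a..b}" and x: "\<bar>x\<bar> \<le> L"
  shows "((\<lambda>s. E s x) has_real_derivative - J L t x) (at t within {a..b})"
proof -
  have tc: "t \<in> confined L" using conf t by auto
  have "((\<lambda>s. 1/2 * (integral {-L..x} (rho s) - integral {x..L} (rho s))) has_real_derivative
     1/2 * ((J L t (-L) - J L t x) - (J L t x - J L t L))) (at t within {a..b})"
    by (intro derivative_intros DERIV_cmult integral_rho_dt[OF conf L t]) (use x in auto)
  also have "1/2 * ((J L t (-L) - J L t x) - (J L t x - J L t L)) = - J L t x"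
    using L by (simp add: mom_outside[OF tc])
  finally show ?thesis
    by (rule has_field_derivative_eq_on) (use E_eq[OF _ x] conf t in auto)
qed

lemma E_dx:
  assumes t: "t \<in> confined L" and x: "x \<in> {-L..L}"
  shows "((\<lambda>y. E t y) has_real_derivative rho t x) (at x within {-L..L})"
proof -
  have "((\<lambda>x. integral {-L..x} (rho t) - mass t / 2) has_real_derivative rho t x) (at x within {-L..L})"
    by (rule derivative_eq_intros integral_has_real_derivative[OF rho_cont x] confined_nonneg[OF t] refl | simp)+
  then show ?thesis
    by (rule has_field_derivative_eq_on) (use E_eq_mass[OF t] x in auto)
qed

lemma mass_const:
  assumes ab: "a \<le> b" and conf: "{a..b} \<subseteq> confined L" and t: "t \<in> {a..b}"
  shows "mass t = mass a"
proof -
  define L' where "L' = max L 1"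
  have conf': "{a..b} \<subseteq> confined L'" using conf confined_mono[of L L'] by (auto simp: L'_def)
  have L': "0 < L'" by (simp add: L'_def)
  have "((\<lambda>s. integral {-L'..L'} (rho s)) has_real_derivative 0) (at s within {a..b})" if "s \<in> {a..b}" for s
    using integral_rho_dt[OF conf' L' that, of "-L'" L'] L' conf' that
    by (simp add: mom_outside[of s L'] subset_iff)
  then have "integral {-L'..L'} (rho t) = integral {-L'..L'} (rho a)"
    using has_field_derivative_zero_constant[of "{a..b}" "\<lambda>s. integral {-L'..L'} (rho s)"] t by auto
  moreover have "t \<in> confined L'" "a \<in> confined L'" using conf' t by auto
  ultimately show ?thesis by (simp add: mass_eq)
qed

end

subsection \<open>Locally uniform bounds on the support\<close>

text \<open>Otherwise each \<open>B - F n\<close> is relatively open and dense in \<open>B\<close>,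
  so by Baire's theorem their intersection is dense in \<open>B\<close>; but it is empty, because
  the \<open>F n\<close> cover \<open>B\<close>.\<close>

lemma Baire_closed_cover:
  fixes B :: "'a::{real_normed_vector, heine_borel} set" and F :: "nat \<Rightarrow> 'a set"
  assumes B: "closed B" "B \<noteq> {}" and F: "\<And>n. closed (F n)" and cover: "B \<subseteq> (\<Union>n. F n)"
  shows "\<exists>n. \<exists>x\<in>B. \<exists>e>0. B \<inter> ball x e \<subseteq> F n"
proof (rule ccontr)
  assume neg: "\<not> ?thesis"
  have "B \<subseteq> closure (\<Inter> (range (\<lambda>n. B - F n)))"
  proof (rule Baire[OF B(1)])
    fix T assume "T \<in> range (\<lambda>n. B - F n)"
    then obtain n where T: "T = B - F n" by blast
    have "openin (top_of_set B) T"
      unfolding T openin_open by (rule exI[of _ "- F n"]) (use F in auto)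
    moreover have "B \<subseteq> closure T"
    proof
      fix x assume x: "x \<in> B"
      show "x \<in> closure T"
        unfolding closure_approachable
      proof safe
        fix e :: real assume "e > 0"
        then have "\<not> B \<inter> ball x e \<subseteq> F n" using neg x by blast
        then show "\<exists>y\<in>T. dist y x < e" by (auto simp: T dist_commute)
      qed
    qed
    ultimately show "openin (top_of_set B) T \<and> B \<subseteq> closure T" ..
  qed simp
  moreover have "\<Inter> (range (\<lambda>n. B - F n)) = {}" using cover by auto
  ultimately show False using B(2) by (metis closure_empty subset_empty)
qed

lemma abs_rel_velocity_fst_le: "\<bar>fst (rel_velocity v)\<bar> \<le> 1"
proof -
  have "\<bar>fst v\<bar> \<le> sqrt ((norm v)\<^sup>2)" using norm_fst_le[of "fst v" "snd v"] by simp
  also have "\<dots> \<le> sqrt (1 + (norm v)\<^sup>2)" by (rule real_sqrt_le_mono) simp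
  finally show ?thesis by (simp add: rel_velocity_fst divide_le_eq_1 add_pos_nonneg)
qed

context rvp
begin

text \<open>Each bound takes two uses of \<open>support_speed\<close>, with a coordinate direction
  and its negative. As the mass is constant on the interval, its value at \<open>c\<close> controls
  the field throughout.\<close>

lemma speed_bounds:
  assumes ab: "a \<le> b" and conf: "{a..b} \<subseteq> confined L" and c: "c = a \<or> c = b"
    and t: "t \<in> {a..b}" and ne: "f t x (v1, v2) \<noteq> 0"
  shows "(\<And>x v1 v2. f c x (v1, v2) \<noteq> 0 \<Longrightarrow> \<bar>x\<bar> \<le> r) \<Longrightarrow> \<bar>x\<bar> \<le> r + \<bar>t - c\<bar>"
    and "(\<And>x v1 v2. f c x (v1, v2) \<noteq> 0 \<Longrightarrow> \<bar>v1\<bar> \<le> r) \<Longrightarrow> \<bar>v1\<bar> \<le> r + mass c / 2 * \<bar>t - c\<bar>"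
    and "(\<And>x v1 v2. f c x (v1, v2) \<noteq> 0 \<Longrightarrow> \<bar>v2\<bar> \<le> r) \<Longrightarrow> \<bar>v2\<bar> \<le> r"
proof -
  obtain \<sigma> :: real where \<sigma>: "\<sigma> = 1 \<and> c = a \<or> \<sigma> = -1 \<and> c = b" using c by blast
  note sp = support_speed[OF ab conf \<sigma> _ _ t ne]
  have mc: "mass s = mass c" if "s \<in> {a..b}" for s
    using mass_const[OF ab conf that] mass_const[OF ab conf, of c] c ab by auto
  have Eb: "\<bar>E s y\<bar> \<le> mass c / 2" if "s \<in> {a..b}" "f s y v \<noteq> 0" for s y v
    using E_bound_support[OF _ that(2)] that(1) conf confined_nonneg mc[OF that(1)] by auto
  show "\<bar>x\<bar> \<le> r + \<bar>t - c\<bar>" if init: "\<And>x v1 v2. f c x (v1, v2) \<noteq> 0 \<Longrightarrow> \<bar>x\<bar> \<le> r"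
  proof -
    have "1 * x + 0 * v1 + 0 * v2 \<le> r + 1 * \<bar>t - c\<bar>"
      by (rule sp) (use init abs_rel_velocity_fst_le in \<open>auto dest: abs_le_D1\<close>)
    moreover have "-1 * x + 0 * v1 + 0 * v2 \<le> r + 1 * \<bar>t - c\<bar>"
      by (rule sp) (use init abs_rel_velocity_fst_le in \<open>auto dest: abs_le_D2\<close>)
    ultimately show ?thesis by (simp add: abs_le_iff)
  qed
  show "\<bar>v1\<bar> \<le> r + mass c / 2 * \<bar>t - c\<bar>" if init: "\<And>x v1 v2. f c x (v1, v2) \<noteq> 0 \<Longrightarrow> \<bar>v1\<bar> \<le> r"
  proof -
    have "0 * x + 1 * v1 + 0 * v2 \<le> r + mass c / 2 * \<bar>t - c\<bar>"
      by (rule sp) (use init Eb in \<open>auto dest: abs_le_D1\<close>)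
    moreover have "0 * x + -1 * v1 + 0 * v2 \<le> r + mass c / 2 * \<bar>t - c\<bar>"
      by (rule sp) (use init Eb in \<open>auto dest: abs_le_D2\<close>)
    ultimately show ?thesis by (simp add: abs_le_iff)
  qed
  show "\<bar>v2\<bar> \<le> r" if init: "\<And>x v1 v2. f c x (v1, v2) \<noteq> 0 \<Longrightarrow> \<bar>v2\<bar> \<le> r"
  proof -
    have "0 * x + 0 * v1 + 1 * v2 \<le> r + 0 * \<bar>t - c\<bar>"
      by (rule sp) (use init in \<open>auto dest: abs_le_D1\<close>)
    moreover have "0 * x + 0 * v1 + -1 * v2 \<le> r + 0 * \<bar>t - c\<bar>"
      by (rule sp) (use init in \<open>auto dest: abs_le_D2\<close>)
    ultimately show ?thesis by (simp add: abs_le_iff)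
  qed
qed

text \<open>\<open>L\<close> enters only qualitatively: the new size depends on the data at
  \<open>c\<close> and the length of the interval. This is what lets bounds pass to the limit of
  growing intervals.\<close>

lemma confined_spread:
  assumes ab: "a \<le> b" and conf: "{a..b} \<subseteq> confined L" and c: "c = a \<or> c = b" "c \<in> confined r"
    and t: "t \<in> {a..b}" and R: "r + (1 + mass c / 2) * (b - a) < R"
  shows "t \<in> confined R"
proof (rule confinedI)
  show "0 \<le> t" using t conf confined_nonneg by auto
  fix x v1 v2 assume ne: "f t x (v1, v2) \<noteq> 0"
  have c0: "0 \<le> mass c" using mass_nonneg c(2) confined_nonneg by blast
  have tc: "\<bar>t - c\<bar> \<le> b - a" using t c(1) by auto
  note sb = speed_bounds[OF ab conf c(1) t ne, of r]
  have "\<bar>x\<bar> \<le> r + \<bar>t - c\<bar>" "\<bar>v1\<bar> \<le> r + mass c / 2 * \<bar>t - c\<bar>" "\<bar>v2\<bar> \<le> r"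
    by (rule sb; use confinedD[OF c(2)] in force)+
  moreover have "mass c / 2 * \<bar>t - c\<bar> \<le> mass c / 2 * (b - a)" "0 \<le> mass c / 2 * \<bar>t - c\<bar>"
    using c0 tc by (auto intro!: mult_left_mono)
  moreover have "r + (b - a) + mass c / 2 * (b - a) < R" using R by (simp add: algebra_simps)
  ultimately show "\<bar>x\<bar> < R \<and> \<bar>v1\<bar> < R \<and> \<bar>v2\<bar> < R" using tc by linarith
qed

text \<open>As a union of open sets it is open at once, and its compact intervals have finite
  subcovers. The intersection with \<open>{0..}\<close> leaves negative times unrestricted, since
  \<open>f\<close> has no meaning there.\<close>

definition good_times :: "real set" where
  "good_times = \<Union> {U. open U \<and> (\<exists>L. U \<inter> {0..} \<subseteq> confined L)}"

lemma open_good_times: "open good_times"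
  unfolding good_times_def by (rule open_Union) auto

lemma good_interval:
  assumes "0 \<le> a" "{a..b} \<subseteq> good_times"
  shows "\<exists>L. {a..b} \<subseteq> confined L"
proof -
  obtain D where D: "D \<subseteq> {U. open U \<and> (\<exists>L. U \<inter> {0..} \<subseteq> confined L)}" "finite D" "{a..b} \<subseteq> \<Union> D"
    by (rule compactE[OF compact_Icc[of a b] assms(2)[unfolded good_times_def]]) auto
  then have "\<forall>U\<in>D. \<exists>L. U \<inter> {0..} \<subseteq> confined L" by auto
  then obtain l where l: "\<And>U. U \<in> D \<Longrightarrow> U \<inter> {0..} \<subseteq> confined (l U)" by metis
  define L where "L = Max (insert 0 (l ` D))"
  have "t \<in> confined L" if t: "t \<in> {a..b}" for t
  proof -
    obtain U where U: "U \<in> D" "t \<in> U" using D(3) t by blast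
    have "l U \<le> L" unfolding L_def using D(2) U(1) by (intro Max_ge) auto
    then show ?thesis using l[OF U(1)] U(2) t assms(1) confined_mono by fastforce
  qed
  then show ?thesis by blast
qed

text \<open>For \<open>a < s\<close> the interval \<open>{s..t}\<close> has some common cube, and
  \<open>confined_spread\<close>, followed backwards from \<open>t\<close>, replaces it by a size
  \<open>R\<close> independent of \<open>s\<close>. The endpoint \<open>a\<close>, possibly a bad
  time, has its own bound \<open>n\<close>.\<close>

lemma extend_left:
  assumes at: "a < t" and good: "{a<..t} \<subseteq> good_times" and a: "a \<in> confined n"
  shows "\<exists>L. {a..t} \<subseteq> confined L"
proof -
  have a0: "0 \<le> a" using a by (rule confined_nonneg)
  obtain r where r: "t \<in> confined r" by (rule confined_ex[of t]) (use a0 at in auto)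
  define R where "R = r + (1 + mass t / 2) * (t - a) + 1"
  have "s \<in> confined (max n R)" if s: "s \<in> {a..t}" for s
  proof (cases "s = a")
    case True
    then show ?thesis using a confined_mono[of n "max n R"] by auto
  next
    case False
    then have "{s..t} \<subseteq> good_times" using good s by auto
    then obtain L where L: "{s..t} \<subseteq> confined L" using good_interval[of s t] s a0 by auto
    have "(1 + mass t / 2) * (t - s) \<le> (1 + mass t / 2) * (t - a)"
      using mass_nonneg[of t] s a0 by (intro mult_left_mono) auto
    then have "s \<in> confined R"
      by (intro confined_spread[OF _ L _ r]) (use s in \<open>auto simp: R_def\<close>)
    then show ?thesis using confined_mono[of R "max n R"] by auto
  qed
  then show ?thesis by blast
qed

lemma extend_right:
  assumes t: "0 \<le> t" "t < b" and good: "{t..<b} \<subseteq> good_times" and b: "b \<in> confined n"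
  shows "\<exists>L. {t..b} \<subseteq> confined L"
proof -
  obtain r where r: "t \<in> confined r" by (rule confined_ex[OF t(1)])
  define R where "R = r + (1 + mass t / 2) * (b - t) + 1"
  have "s \<in> confined (max n R)" if s: "s \<in> {t..b}" for s
  proof (cases "s = b")
    case True
    then show ?thesis using b confined_mono[of n "max n R"] by auto
  next
    case False
    then have "{t..s} \<subseteq> good_times" using good s by auto
    then obtain L where L: "{t..s} \<subseteq> confined L" using good_interval[OF t(1)] by blast
    have "(1 + mass t / 2) * (s - t) \<le> (1 + mass t / 2) * (b - t)"
      using mass_nonneg[OF t(1)] s by (intro mult_left_mono) auto
    then have "s \<in> confined R"
      by (intro confined_spread[OF _ L _ r]) (use s in \<open>auto simp: R_def\<close>)
    then show ?thesis using confined_mono[of R "max n R"] by auto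
  qed
  then show ?thesis by blast
qed

text \<open>At each point of phase space outside the open cube, the times where \<open>f\<close>
  vanishes form a closed set by continuity; the set in question is the intersection of
  these.\<close>

lemma closed_confined: "closed (confined L)"
proof -
  have "closed {t \<in> {0..}. f t (fst z) (snd z) = 0}" for z
    by (intro continuous_closed_preimage_constant f_comp continuous_intros) auto
  then have "closed ({0..} \<inter> (\<Inter>z \<in> - {z. \<bar>fst z\<bar> < L \<and> \<bar>fst (snd z)\<bar> < L \<and> \<bar>snd (snd z)\<bar> < L}.
      {t \<in> {0..}. f t (fst z) (snd z) = 0}))" (is "closed ?S")
    by (intro closed_Int closed_INT) auto
  also have "?S = confined L"
  proof (intro equalityI subsetI)
    fix t assume t: "t \<in> ?S"
    show "t \<in> confined L"
    proof (rule confinedI)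
      show "0 \<le> t" using t by simp
      fix x v1 v2 assume "f t x (v1, v2) \<noteq> 0"
      then show "\<bar>x\<bar> < L \<and> \<bar>v1\<bar> < L \<and> \<bar>v2\<bar> < L"
        using INT_D[OF IntD2[OF t], of "(x, v1, v2)"] by auto
    qed
  next
    fix t assume t: "t \<in> confined L"
    then show "t \<in> ?S"
      using confinedD[OF t] confined_nonneg[OF t] by fastforce
  qed
  finally show ?thesis .
qed

text \<open>On \<open>confined L\<close> the mass agrees with the integral of the cut-off density.
  That integral is continuous on all of \<open>{0..T}\<close>, so it is bounded however scattered
  \<open>confined L\<close> may be.\<close>

lemma mass_bounded_on_confined: "\<exists>K\<ge>0. \<forall>t \<in> confined L \<inter> {0..T}. mass t \<le> K"
proof -
  let ?m = "\<lambda>t. integral (cbox (-L) L) (mom L (\<lambda>_. 1) t)"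
  have "continuous_on {0..T} ?m"
    by (rule integral_continuous_on_param, unfold case_prod_unfold, intro mom_comp continuous_intros) auto
  then have "bounded (?m ` {0..T})"
    by (intro compact_imp_bounded compact_continuous_image) auto
  then obtain K where K: "\<And>t. t \<in> {0..T} \<Longrightarrow> \<bar>?m t\<bar> \<le> K"
    unfolding bounded_iff by fastforce
  have "mass t \<le> max K 0" if "t \<in> confined L" "t \<in> {0..T}" for t
  proof -
    have "rho t = mom L (\<lambda>_. 1) t" using rho_mom[OF that(1)] by blast
    then show ?thesis using K[OF that(2)] mass_eq[OF that(1)] by auto
  qed
  then show ?thesis by (intro exI[of _ "max K 0"]) auto
qed

text \<open>
  The compact supports at different times are not assumed to be locally uniformly bounded.
  By Baire's theorem the set of bad times, if nonempty, has a relatively open piece with a common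
  support bound, hence with bounded mass. On the gaps of that piece the mass is constant, so
  the field is bounded there and the support cannot spread far, contradicting badness.
\<close>

lemma all_times_good: "{0..} \<subseteq> good_times"
proof (rule ccontr)
  assume "\<not> ?thesis"
  define B where "B = {0..} - good_times"
  have B: "closed B" "B \<noteq> {}"
    using open_good_times \<open>\<not> {0..} \<subseteq> good_times\<close> by (auto simp: B_def)
  have cover: "B \<subseteq> (\<Union>n. confined (real n))"
  proof
    fix t assume "t \<in> B"
    then obtain L where L: "t \<in> confined L" using confined_ex[of t] by (auto simp: B_def)
    obtain n where "L \<le> real n" using real_arch_simple by blast
    then show "t \<in> (\<Union>n. confined (real n))" using L confined_mono[of L "real n"] by auto
  qed
  obtain n t0 e where n: "t0 \<in> B" "e > 0" "B \<inter> ball t0 e \<subseteq> confined (real n)"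
    using Baire_closed_cover[OF B closed_confined cover] by blast
  obtain K where K: "0 \<le> K" "\<And>t. t \<in> confined (real n) \<Longrightarrow> t \<le> t0 + e \<Longrightarrow> mass t \<le> K"
    using mass_bounded_on_confined[of "real n" "t0 + e"] confined_nonneg by force
  \<comment> \<open>The gaps below have length at most \<open>e\<close> and an endpoint in the Baire
    piece, where the cube has size \<open>n\<close> and the mass is at most \<open>K\<close>; the
    final 1 gives strict inequality.\<close>
  define R where "R = real n + (1 + K / 2) * e + 1"
  have spread: "t \<in> confined R"
    if "a \<le> b" "{a..b} \<subseteq> confined L" "c = a \<or> c = b" "c \<in> B \<inter> ball t0 e" "t \<in> {a..b}" "b - a \<le> e" for a b c t L
  proof -
    have cn: "c \<in> confined (real n)" using that n by blast
    have mK: "mass c \<le> K" using K(2)[OF cn] that(4) by (auto simp: dist_real_def)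
    have "0 \<le> mass c" by (rule mass_nonneg[OF confined_nonneg[OF cn]])
    then have "(1 + mass c / 2) * (b - a) \<le> (1 + K / 2) * e"
      by (intro mult_mono) (use mK that K in auto)
    then show ?thesis
      by (intro confined_spread[OF that(1,2,3) cn that(5)]) (simp add: R_def)
  qed
  have "t \<in> confined R" if t: "t \<in> ball t0 e" "0 \<le> t" for t
  proof (cases "t \<in> B")
    case True
    have "real n \<le> R" using K(1) n(2) by (simp add: R_def)
    then show ?thesis using True n(3) t confined_mono[of "real n" R] by blast
  next
    case False
    have tG: "t \<in> good_times" using False t by (simp add: B_def)
    have "t \<noteq> t0" using False n by auto
    then consider "t0 < t" | "t < t0" by linarith
    then show ?thesis
    proof cases
      case 1
      have "compact (B \<inter> {t0..t})" "B \<inter> {t0..t} \<noteq> {}"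
        using B(1) n(1) 1 by (auto intro: closed_Int_compact)
      \<comment> \<open>\<open>a\<close> is the last bad time up to \<open>t\<close>, so the gap
        \<open>{a<..t}\<close> consists of good times. Lying between \<open>t0\<close> and
        \<open>t\<close>, it belongs to the ball.\<close>
      then obtain a where a: "a \<in> B" "t0 \<le> a" "a \<le> t" "\<And>s. s \<in> B \<inter> {t0..t} \<Longrightarrow> s \<le> a"
        using compact_attains_sup[of "B \<inter> {t0..t}"] by (metis IntE atLeastAtMost_iff)
      have at: "a < t" using a False by (metis order_le_less)
      have good: "{a<..t} \<subseteq> good_times"
      proof
        fix s assume s: "s \<in> {a<..t}"
        show "s \<in> good_times"
        proof (rule ccontr)
          assume "s \<notin> good_times"
          then have "s \<in> B \<inter> {t0..t}" using s a confined_nonneg[of a] n(1) by (auto simp: B_def)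
          then show False using a(4)[of s] s by simp
        qed
      qed
      have ab: "a \<in> B \<inter> ball t0 e" using a t by (auto simp: dist_real_def)
      obtain L where L: "{a..t} \<subseteq> confined L"
        using extend_left[OF at good] ab n(3) by blast
      show ?thesis
        by (rule spread[OF _ L _ ab]) (use at t a in \<open>auto simp: dist_real_def\<close>)
    next
      case 2
      have "compact (B \<inter> {t..t0})" "B \<inter> {t..t0} \<noteq> {}"
        using B(1) n(1) 2 by (auto intro: closed_Int_compact)
      then obtain b where b: "b \<in> B" "b \<le> t0" "t \<le> b" "\<And>s. s \<in> B \<inter> {t..t0} \<Longrightarrow> b \<le> s"
        using compact_attains_inf[of "B \<inter> {t..t0}"] by (metis IntE atLeastAtMost_iff)
      have tb: "t < b" using b False by (metis order_le_less)
      have good: "{t..<b} \<subseteq> good_times"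
      proof
        fix s assume s: "s \<in> {t..<b}"
        show "s \<in> good_times"
        proof (rule ccontr)
          assume "s \<notin> good_times"
          then have "s \<in> B \<inter> {t..t0}" using s b t by (auto simp: B_def)
          then show False using b(4)[of s] s by simp
        qed
      qed
      have bb: "b \<in> B \<inter> ball t0 e" using b t by (auto simp: dist_real_def)
      obtain L where L: "{t..b} \<subseteq> confined L"
        using extend_right[OF t(2) tb good] bb n(3) by blast
      show ?thesis
        by (rule spread[OF _ L _ bb]) (use tb t b in \<open>auto simp: dist_real_def\<close>)
    qed
  qed
  then have "ball t0 e \<inter> {0..} \<subseteq> confined R" by blast
  then have "ball t0 e \<subseteq> good_times"
    unfolding good_times_def by (intro Union_upper CollectI conjI exI) auto
  moreover have "t0 \<in> ball t0 e" using n(2) by simp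
  ultimately show False using n(1) unfolding B_def by blast
qed

lemma uniformly_confined: obtains L where "0 < L" "{0..T} \<subseteq> confined L"
proof -
  obtain L where "{0..T} \<subseteq> confined L"
    using good_interval[of 0 T] all_times_good by fastforce
  then show thesis using that[of "max L 1"] confined_mono[of L "max L 1"] by auto
qed

lemma mass_conserved: "0 \<le> t \<Longrightarrow> mass t = mass 0"
  by (metis atLeastAtMost_iff mass_const order_refl uniformly_confined)

end

subsection \<open>Growth of the weighted field moment\<close>

text \<open>Two properties motivate the choice: it is a monotone function of the velocity alone, and
  its derivative in the first component depends only on the second, whose range on the support does
  not grow.\<close>

definition rel_weight :: "real \<times> real \<Rightarrow> real" where
  "rel_weight v = fst v / sqrt (1 + (snd v)\<^sup>2)"

lemma continuous_on_rel_weight: "continuous_on A rel_weight"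
  unfolding rel_weight_def[abs_def]
  by (intro continuous_intros) (auto simp: add_nonneg_eq_0_iff)

lemma continuous_on_inverse_sqrt_snd: "continuous_on A (\<lambda>v :: real \<times> real. 1 / sqrt (1 + (snd v)\<^sup>2))"
  by (intro continuous_intros) (auto simp: add_nonneg_eq_0_iff)

lemma abs_rel_weight_le: "\<bar>rel_weight v\<bar> \<le> \<bar>fst v\<bar>"
proof -
  have "\<bar>fst v\<bar> / sqrt (1 + (snd v)\<^sup>2) \<le> \<bar>fst v\<bar> / 1"
    by (intro divide_left_mono) (auto simp: add_pos_nonneg)
  then show ?thesis by (simp add: rel_weight_def)
qed

lemma rel_velocity_fst_sq_less: "(fst (rel_velocity v))\<^sup>2 < 1"
  by (cases v) (auto simp: rel_velocity_fst norm_Pair power_divide divide_less_eq_1 add_pos_nonneg)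

text \<open>One minus the squared velocity equals \<open>(1 + v2\<^sup>2) / n\<close>, so the
  factors \<open>sqrt n\<close> cancel. Hence the weight sees \<open>v\<close> only through its
  velocity.\<close>

lemma rel_weight_eq: "rel_weight v = fst (rel_velocity v) / sqrt (1 - (fst (rel_velocity v))\<^sup>2)"
proof -
  obtain v1 v2 where v: "v = (v1, v2)" by (cases v)
  define n where "n = 1 + v1\<^sup>2 + v2\<^sup>2"
  have n: "n > 0" unfolding n_def by (simp add: add_pos_nonneg)
  have V: "fst (rel_velocity v) = v1 / sqrt n"
    by (simp add: v rel_velocity_fst norm_Pair n_def add.assoc)
  have "1 - (v1 / sqrt n)\<^sup>2 = (1 + v2\<^sup>2) / n"
    using n by (simp add: power_divide field_simps n_def)
  then have "sqrt (1 - (v1 / sqrt n)\<^sup>2) = sqrt (1 + v2\<^sup>2) / sqrt n"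
    by (simp add: real_sqrt_divide)
  moreover have "rel_weight v = v1 / sqrt (1 + v2\<^sup>2)" by (simp add: rel_weight_def v)
  ultimately show ?thesis using n unfolding V by simp
qed

text \<open>For nonnegative arguments the numerator grows while the denominator shrinks. The map is
  odd, which settles negative arguments, and zero separates arguments of opposite sign.\<close>

lemma divide_sqrt_one_minus_sq_mono:
  fixes s t :: real
  assumes "s \<le> t" "s\<^sup>2 < 1" "t\<^sup>2 < 1"
  shows "s / sqrt (1 - s\<^sup>2) \<le> t / sqrt (1 - t\<^sup>2)"
proof -
  have pos: "0 < sqrt (1 - s\<^sup>2)" "0 < sqrt (1 - t\<^sup>2)" using assms by auto
  consider "0 \<le> s" | "s < 0" "0 \<le> t" | "t < 0" using assms by linarith
  then show ?thesis
  proof cases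
    case 1
    then have "sqrt (1 - t\<^sup>2) \<le> sqrt (1 - s\<^sup>2)" using assms by (simp add: power_mono)
    then show ?thesis using 1 assms pos by (intro frac_le) auto
  next
    case 2
    then have "s / sqrt (1 - s\<^sup>2) \<le> 0" "0 \<le> t / sqrt (1 - t\<^sup>2)" using pos by (auto simp: divide_le_0_iff)
    then show ?thesis by linarith
  next
    case 3
    have "t\<^sup>2 \<le> s\<^sup>2" using power_mono[of "-t" "-s" 2] 3 assms by simp
    then have "sqrt (1 - s\<^sup>2) \<le> sqrt (1 - t\<^sup>2)" by simp
    then have "(-t) / sqrt (1 - t\<^sup>2) \<le> (-s) / sqrt (1 - s\<^sup>2)" using 3 assms pos by (intro frac_le) auto
    then show ?thesis by simp
  qed
qed

text \<open>Dropping \<open>v2\<close> enlarges the quotient, and \<open>y / (1 + y)\<close>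
  increases in \<open>y = v1\<^sup>2\<close>. What matters is a bound strictly below 1 on the whole
  cube, which mean velocities inherit.\<close>

lemma abs_rel_velocity_fst_le_bounded:
  assumes "\<bar>fst v\<bar> \<le> L"
  shows "\<bar>fst (rel_velocity v)\<bar> \<le> sqrt (L\<^sup>2 / (1 + L\<^sup>2))"
proof -
  obtain v1 v2 where v: "v = (v1, v2)" by (cases v)
  have v1: "v1\<^sup>2 \<le> L\<^sup>2" using assms v by (simp add: abs_le_square_iff[symmetric])
  have "v1\<^sup>2 / (1 + v1\<^sup>2 + v2\<^sup>2) \<le> L\<^sup>2 / (1 + L\<^sup>2)"
  proof (rule order_trans)
    show "v1\<^sup>2 / (1 + v1\<^sup>2 + v2\<^sup>2) \<le> v1\<^sup>2 / (1 + v1\<^sup>2)"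
      by (intro divide_left_mono) (auto intro!: mult_pos_pos add_pos_nonneg)
    show "v1\<^sup>2 / (1 + v1\<^sup>2) \<le> L\<^sup>2 / (1 + L\<^sup>2)"
      using v1 by (simp add: divide_simps add_pos_nonneg) (simp add: algebra_simps add_nonneg_eq_0_iff)
  qed
  then have "sqrt (v1\<^sup>2 / (1 + v1\<^sup>2 + v2\<^sup>2)) \<le> sqrt (L\<^sup>2 / (1 + L\<^sup>2))" by simp
  then show ?thesis
    by (simp add: v rel_velocity_fst norm_Pair real_sqrt_divide add.assoc)
qed

context rvp
begin

abbreviation "\<Phi> L t x \<equiv> mom L rel_weight t x"
abbreviation "P L t x \<equiv> mom L (\<lambda>v. rel_weight v * V1 v) t x"
abbreviation "N L t x \<equiv> mom L (\<lambda>v. 1 / sqrt (1 + (snd v)\<^sup>2)) t x"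

lemma continuous_on_flux_weight: "continuous_on A (\<lambda>v. rel_weight v * V1 v)"
  by (intro continuous_intros continuous_on_rel_weight continuous_on_rel_velocity)

lemma mom_mono:
  assumes "0 \<le> t" "continuous_on UNIV w" "continuous_on UNIV w'"
    and "\<And>v. f t x v \<noteq> 0 \<Longrightarrow> v \<in> cbox (-L, -L) (L, L) \<Longrightarrow> w v \<le> w' v"
  shows "mom L w t x \<le> mom L w' t x"
  unfolding mom_def
proof (rule integral_le)
  fix v assume "v \<in> cbox (-L, -L) (L, L)"
  then show "w v * f t x v \<le> w' v * f t x v"
    using assms(4)[of v] f_nonneg[OF assms(1), of x v] by (cases "f t x v = 0") (auto intro: mult_right_mono)
qed (use integrable_weighted assms in auto)

lemma mom_scale: "mom L (\<lambda>v. k * w v) t x = k * mom L w t x"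
  by (simp add: mom_def mult.assoc)

text \<open>
  Chebyshev's inequality for the particle distribution at a point: \<open>rel_weight\<close> is an
  increasing function of the velocity \<open>V1\<close>. With \<open>c\<close> the mean velocity and \<open>d\<close> the value of the
  weight at velocity \<open>c\<close>, the integral of \<open>(rel_weight - d) * (V1 - c)\<close> is nonnegative.
\<close>

lemma moment_correlation:
  assumes t: "t \<in> confined L"
  shows "J L t x * \<Phi> L t x \<le> rho t x * P L t x"
proof -
  have t0: "0 \<le> t" using t by (rule confined_nonneg)
  define r where "r = rho t x"
  have r: "mom L (\<lambda>_. 1) t x = r" by (simp add: r_def rho_mom[OF t])
  have r0: "0 \<le> r" by (simp add: r_def rho_nonneg t0)
  define \<kappa> where "\<kappa> = sqrt (L\<^sup>2 / (1 + L\<^sup>2))"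
  have \<kappa>: "0 \<le> \<kappa>" "\<kappa> < 1"
    by (auto simp: \<kappa>_def real_sqrt_lt_1_iff divide_less_eq_1 add_pos_nonneg)
  have V_le: "\<bar>V1 v\<bar> \<le> \<kappa>" if "v \<in> cbox (-L, -L) (L, L)" for v
    unfolding \<kappa>_def by (rule abs_rel_velocity_fst_le_bounded) (use that in \<open>cases v; auto\<close>)
  have "J L t x \<le> mom L (\<lambda>_. \<kappa> * 1) t x"
    by (rule mom_mono) (use t0 V_le in \<open>auto intro: continuous_on_rel_velocity dest: abs_le_D1\<close>)
  moreover have "mom L (\<lambda>_. - \<kappa> * 1) t x \<le> J L t x"
    by (rule mom_mono) (use t0 V_le in \<open>force intro: continuous_on_rel_velocity dest: abs_le_D2\<close>)+
  ultimately have J: "\<bar>J L t x\<bar> \<le> \<kappa> * r" unfolding mom_scale r by (simp add: abs_le_iff)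
  show ?thesis
  proof (cases "r = 0")
    case True
    then show ?thesis using J by (simp add: r_def)
  next
    case False
    then have rpos: "r > 0" using r0 by simp
    define c where "c = J L t x / r"
    have Jc: "J L t x = c * r" using rpos by (simp add: c_def)
    have "\<bar>c\<bar> \<le> \<kappa>" using J rpos by (simp add: c_def divide_le_eq abs_mult)
    then have c1: "c\<^sup>2 < 1" using \<kappa> by (simp add: abs_square_less_1)
    define d where "d = c / sqrt (1 - c\<^sup>2)"
    have "0 \<le> (rel_weight v - d) * (V1 v - c)" for v
    proof (cases "c \<le> V1 v")
      case True
      then have "d \<le> rel_weight v"
        unfolding d_def rel_weight_eq by (intro divide_sqrt_one_minus_sq_mono c1 rel_velocity_fst_sq_less)
      then show ?thesis using True by simp
    next
      case False
      then have "rel_weight v \<le> d"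
        unfolding d_def rel_weight_eq by (intro divide_sqrt_one_minus_sq_mono c1 rel_velocity_fst_sq_less) simp
      then show ?thesis using False by (intro mult_nonpos_nonpos) auto
    qed
    then have nn: "0 \<le> (rel_weight v - d) * (V1 v - c) * f t x v" for v
      using f_nonneg[OF t0] by simp
    have hI: "((\<lambda>v. w v * f t x v) has_integral mom L w t x) (cbox (-L, -L) (L, L))"
      if "continuous_on UNIV w" for w
      unfolding mom_def by (rule integrable_integral[OF integrable_weighted(1)[OF that t0]])
    have "((\<lambda>v. (rel_weight v * V1 v * f t x v - c * (rel_weight v * f t x v))
        - (d * (V1 v * f t x v) - d * c * (1 * f t x v))) has_integral
        P L t x - c * \<Phi> L t x - (d * J L t x - d * c * mom L (\<lambda>_. 1) t x)) (cbox (-L, -L) (L, L))"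
      by (intro has_integral_diff has_integral_mult_right hI continuous_on_flux_weight
          continuous_on_rel_weight continuous_on_rel_velocity continuous_on_const)
    then have "0 \<le> P L t x - c * \<Phi> L t x - (d * J L t x - d * c * r)"
      unfolding r by (rule has_integral_nonneg) (use nn in \<open>simp add: algebra_simps\<close>)
    \<comment> \<open>Since \<open>c\<close> is the mean velocity, the two terms containing
      \<open>d\<close> cancel.\<close>
    also have "\<dots> = P L t x - c * \<Phi> L t x" by (simp add: Jc)
    finally have "r * (c * \<Phi> L t x) \<le> r * P L t x" using rpos by simp
    then show ?thesis by (simp add: Jc r_def mult_ac)
  qed
qed

text \<open>In \<open>x\<close> the field is Lipschitz with a constant uniform in \<open>t\<close>,
  namely a bound on the density; in \<open>t\<close> it is continuous for each fixed
  \<open>x\<close>. Together these give joint continuity.\<close>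

lemma E_joint_cont:
  assumes conf: "{a..b} \<subseteq> confined L" and L: "0 < L"
  shows "continuous_on ({a..b} \<times> {-L..L}) (\<lambda>(t, x). E t x)"
proof (rule continuous_on_TimesI)
  have nn: "0 \<le> t" if "t \<in> {a..b}" for t using conf that confined_nonneg by blast
  have "continuous_on ({a..b} \<times> {-L..L}) (\<lambda>z. mom L (\<lambda>_. 1) (fst z) (snd z))"
    by (intro mom_comp continuous_intros) (use nn in auto)
  then have "bounded ((\<lambda>z. mom L (\<lambda>_. 1) (fst z) (snd z)) ` ({a..b} \<times> {-L..L}))"
    by (intro compact_imp_bounded compact_continuous_image compact_Times) auto
  then obtain K where bnd: "\<forall>z \<in> {a..b} \<times> {-L..L}. \<bar>mom L (\<lambda>_. 1) (fst z) (snd z)\<bar> \<le> K"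
    unfolding bounded_iff by auto
  have K: "\<bar>rho t x\<bar> \<le> max K 0" if "t \<in> {a..b}" "x \<in> {-L..L}" for t x
  proof -
    have "\<bar>mom L (\<lambda>_. 1) t x\<bar> \<le> K"
      using bspec[OF bnd, of "(t, x)"] that by simp
    then show ?thesis using rho_mom[of t L x] that conf by auto
  qed
  have lip: "(max K 0)-lipschitz_on {-L..L} (E t)" if t: "t \<in> {a..b}" for t
  proof (rule lipschitz_onI)
    fix x y assume "x \<in> {-L..L}" "y \<in> {-L..L}"
    then show "dist (E t x) (E t y) \<le> max K 0 * dist x y"
      unfolding dist_norm
      by (intro field_differentiable_bound[where S = "{-L..L}" and f' = "rho t"] E_dx)
        (use K t conf in auto)
  qed simp
  show "local_lipschitz {a..b} {-L..L} E"
  proof (rule local_lipschitzI)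
    show "\<exists>u>0. \<exists>M. \<forall>t\<in>cball t u \<inter> {a..b}. M-lipschitz_on (cball x u \<inter> {-L..L}) (E t)" for t x
      by (rule exI[of _ 1]) (auto intro!: exI[of _ "max K 0"] lipschitz_on_subset[OF lip])
  qed
  show "continuous_on {a..b} (\<lambda>t. E t x)" if "x \<in> {-L..L}" for x
    using E_dt[OF conf L, of _ x] that
    by (intro DERIV_continuous_on[where D = "\<lambda>t. - J L t x"]) auto
qed

definition field_moment :: "real \<Rightarrow> real \<Rightarrow> real" where
  "field_moment L t = integral {-L..L} (\<lambda>x. E t x * \<Phi> L t x)"

lemma E_comp:
  assumes conf: "{a..b} \<subseteq> confined L" and L: "0 < L"
    and "continuous_on A T" "continuous_on A X" "\<And>z. z \<in> A \<Longrightarrow> T z \<in> {a..b}" "\<And>z. z \<in> A \<Longrightarrow> X z \<in> {-L..L}"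
  shows "continuous_on A (\<lambda>z. E (T z) (X z))"
proof -
  have "continuous_on A (\<lambda>z. (T z, X z))" using assms by (intro continuous_intros)
  moreover have "(\<lambda>z. (T z, X z)) ` A \<subseteq> {a..b} \<times> {-L..L}" using assms(5,6) by blast
  ultimately show ?thesis using continuous_on_compose2[OF E_joint_cont[OF conf L]] by fastforce
qed

lemma E_cont: "t \<in> confined L \<Longrightarrow> continuous_on {-L..L} (E t)"
  by (rule DERIV_continuous_on[where D = "rho t"]) (rule E_dx)

lemma weight_balance:
  assumes "t \<in> confined L" "0 < L"
  shows "momt L rel_weight t x = - momx L (\<lambda>v. rel_weight v * V1 v) t x + E t x * N L t x"
proof (rule mom_balance[OF assms continuous_on_rel_weight continuous_on_inverse_sqrt_snd])
  show "((\<lambda>v1. rel_weight (v1, v2)) has_real_derivative 1 / sqrt (1 + (snd (v1, v2))\<^sup>2)) (at v1)" for v1 v2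
    unfolding rel_weight_def fst_conv snd_conv by (rule DERIV_cdivide[OF DERIV_ident])
qed

text \<open>In the product rule \<open>E_dt\<close> contributes \<open>- J * \<Phi>\<close>, and
  \<open>weight_balance\<close> contributes the \<open>N\<close> term and minus \<open>E\<close>
  times the x-derivative of \<open>P\<close>. Integration by parts turns the latter into
  \<open>rho * P\<close>.\<close>

lemma field_moment_dt:
  assumes conf: "{a..b} \<subseteq> confined L" and L: "0 < L" and t: "t \<in> {a..b}"
  shows "(field_moment L has_real_derivative
      integral {-L..L} (\<lambda>x. rho t x * P L t x - J L t x * \<Phi> L t x) + integral {-L..L} (\<lambda>x. (E t x)\<^sup>2 * N L t x))
      (at t within {a..b})"
proof -
  have cs: "s \<in> confined L" if "s \<in> {a..b}" for s using conf that by blast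
  have nn: "0 \<le> s" if "s \<in> {a..b}" for s using cs[OF that] confined_nonneg by blast
  note tc = cs[OF t] and t0 = nn[OF t]
  note conts = continuous_on_rel_weight continuous_on_rel_velocity continuous_on_flux_weight
    continuous_on_inverse_sqrt_snd
  let ?D = "\<lambda>s x. - J L s x * \<Phi> L s x + momt L rel_weight s x * E s x"
  have D: "((\<lambda>s. integral (cbox (-L) L) (\<lambda>x. E s x * \<Phi> L s x)) has_real_derivative integral (cbox (-L) L) (?D t)) (at t within {a..b})"
  proof (rule leibniz_rule_field_derivative)
    show "continuous_on ({a..b} \<times> cbox (- L) L) (\<lambda>(s, x). ?D s x)"
      unfolding case_prod_unfold
      by (intro conts continuous_intros mom_comp momt_comp E_comp[OF conf L]) (use nn in auto)
    show "((\<lambda>s. E s x * \<Phi> L s x) has_real_derivative ?D s x) (at s within {a..b})"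
      if "s \<in> {a..b}" "x \<in> cbox (-L) L" for s x
      by (rule DERIV_mult[OF E_dt[OF conf L that(1)] DERIV_subset[OF mom_dt]])
        (use that nn conts in auto)
    show "(\<lambda>x. E s x * \<Phi> L s x) integrable_on cbox (- L) L" if "s \<in> {a..b}" for s
      by (intro integrable_continuous conts continuous_intros mom_comp E_comp[OF conf L]) (use that nn in auto)
  qed (use t in auto)
  have int: "g integrable_on {-L..L}" if "continuous_on {-L..L} g" for g :: "real \<Rightarrow> real"
    using that by (rule integrable_continuous_real)
  \<comment> \<open>The integrand is the x-derivative of \<open>E * P\<close>, and \<open>P\<close>
    vanishes at both ends.\<close>
  have flux: "integral {-L..L} (\<lambda>x. E t x * momx L (\<lambda>v. rel_weight v * V1 v) t x + rho t x * P L t x) = 0"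
  proof -
    have "((\<lambda>x. E t x * momx L (\<lambda>v. rel_weight v * V1 v) t x + rho t x * P L t x) has_integral
        E t L * P L t L - E t (-L) * P L t (-L)) {-L..L}"
    proof (rule fundamental_theorem_of_calculus)
      fix x assume x: "x \<in> {-L..L}"
      have "((\<lambda>x. E t x * P L t x) has_real_derivative
          rho t x * P L t x + momx L (\<lambda>v. rel_weight v * V1 v) t x * E t x) (at x within {-L..L})"
        by (rule DERIV_mult[OF E_dx[OF tc x] has_field_derivative_at_within[OF mom_dx]]) (use conts t0 in auto)
      then show "((\<lambda>x. E t x * P L t x) has_vector_derivative
          E t x * momx L (\<lambda>v. rel_weight v * V1 v) t x + rho t x * P L t x) (at x within {-L..L})"
        unfolding has_real_derivative_iff_has_vector_derivative[symmetric] by (simp add: algebra_simps)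
    qed (use L in auto)
    then show ?thesis using L by (simp add: mom_outside[OF tc] integral_unique)
  qed
  note ci = conts continuous_intros mom_comp momx_comp E_cont[OF tc] rho_cont[OF t0]
  have "integral {-L..L} (?D t)
      = integral {-L..L} (\<lambda>x. (rho t x * P L t x - J L t x * \<Phi> L t x) + (E t x)\<^sup>2 * N L t x
          - (E t x * momx L (\<lambda>v. rel_weight v * V1 v) t x + rho t x * P L t x))"
    by (rule integral_cong) (simp add: weight_balance[OF tc L] algebra_simps power2_eq_square)
  also have "\<dots> = integral {-L..L} (\<lambda>x. (rho t x * P L t x - J L t x * \<Phi> L t x) + (E t x)\<^sup>2 * N L t x) - 0"
    unfolding flux[symmetric]
    by (rule Henstock_Kurzweil_Integration.integral_diff; intro int ci) (use t0 in auto)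
  also have "\<dots> = integral {-L..L} (\<lambda>x. rho t x * P L t x - J L t x * \<Phi> L t x) + integral {-L..L} (\<lambda>x. (E t x)\<^sup>2 * N L t x)"
    unfolding diff_0_right
    by (rule Henstock_Kurzweil_Integration.integral_add; intro int ci) (use t0 in auto)
  finally show ?thesis using D by (simp add: field_moment_def[abs_def])
qed

text \<open>The electric field is a primitive of the density, so \<open>\<integral> E\<^sup>2 \<rho> = [E\<^sup>3 / 3]\<close>, where \<open>E = \<plusminus> mass / 2\<close> at the ends.\<close>

lemma integral_E_sq_rho:
  assumes t: "t \<in> confined L" and L: "0 < L"
  shows "integral {-L..L} (\<lambda>x. (E t x)\<^sup>2 * rho t x) = mass t ^ 3 / 12"
proof -
  have "((\<lambda>x. (E t x)\<^sup>2 * rho t x) has_integral (E t L) ^ 3 / 3 - (E t (-L)) ^ 3 / 3) {-L..L}"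
  proof (rule fundamental_theorem_of_calculus)
    fix x assume x: "x \<in> {-L..L}"
    show "((\<lambda>x. (E t x) ^ 3 / 3) has_vector_derivative (E t x)\<^sup>2 * rho t x) (at x within {-L..L})"
      unfolding has_real_derivative_iff_has_vector_derivative[symmetric]
      by (rule derivative_eq_intros E_dx[OF t x] refl | simp add: power2_eq_square)+
  qed (use L in auto)
  moreover have "E t L = mass t / 2" "E t (-L) = - (mass t / 2)"
    using E_eq_mass[OF t, of L] E_eq_mass[OF t, of "-L"] mass_eq[OF t] L by auto
  ultimately show ?thesis by (simp add: integral_unique power_divide)
qed

text \<open>By \<open>moment_correlation\<close> the first integral in the derivative is
  nonnegative. In the second, \<open>v2\<close> keeps its initial bound \<open>r\<close>, so
  \<open>N\<close> dominates \<open>rho / sqrt (1 + r\<^sup>2)\<close> and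
  \<open>integral_E_sq_rho\<close> applies.\<close>

lemma field_moment_growth:
  assumes conf: "{0..T} \<subseteq> confined L" and L: "0 < L" and T: "0 \<le> T"
    and r: "\<And>x v1 v2. f 0 x (v1, v2) \<noteq> 0 \<Longrightarrow> \<bar>v2\<bar> \<le> r"
  shows "mass 0 ^ 3 / (12 * sqrt (1 + r\<^sup>2)) * T \<le> field_moment L T - field_moment L 0"
proof -
  let ?k = "1 / sqrt (1 + r\<^sup>2)"
  have lower: "mass 0 ^ 3 / 12 * ?k \<le> integral {-L..L} (\<lambda>x. rho t x * P L t x - J L t x * \<Phi> L t x)
      + integral {-L..L} (\<lambda>x. (E t x)\<^sup>2 * N L t x)" if t: "t \<in> {0..T}" for t
  proof -
    have tc: "t \<in> confined L" using t conf by blast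
    have t0: "0 \<le> t" using t by simp
    note ci = integrable_continuous_real continuous_on_rel_weight continuous_on_rel_velocity
      continuous_on_flux_weight continuous_on_inverse_sqrt_snd continuous_intros mom_comp E_cont[OF tc] rho_cont[OF t0]
    have "0 \<le> integral {-L..L} (\<lambda>x. rho t x * P L t x - J L t x * \<Phi> L t x)"
      by (intro Henstock_Kurzweil_Integration.integral_nonneg ci) (use moment_correlation[OF tc] t0 in auto)
    moreover have "integral {-L..L} (\<lambda>x. (E t x)\<^sup>2 * rho t x * ?k) \<le> integral {-L..L} (\<lambda>x. (E t x)\<^sup>2 * N L t x)"
    proof (rule integral_le)
      fix x
      have "mom L (\<lambda>v. ?k * 1) t x \<le> N L t x"
      proof (rule mom_mono[OF t0 _ continuous_on_inverse_sqrt_snd])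
        fix v assume "f t x v \<noteq> 0"
        then have "f t x (fst v, snd v) \<noteq> 0" by simp
        from speed_bounds(3)[OF T conf _ t this, of 0 r] have "\<bar>snd v\<bar> \<le> r" using r by blast
        then have "(snd v)\<^sup>2 \<le> r\<^sup>2" by (metis abs_ge_zero power2_abs power_mono)
        then show "?k * 1 \<le> 1 / sqrt (1 + (snd v)\<^sup>2)"
          by (auto intro!: divide_left_mono mult_pos_pos add_pos_nonneg)
      qed simp
      then have "rho t x * ?k \<le> N L t x"
        unfolding mom_scale by (simp add: rho_mom[OF tc])
      then show "(E t x)\<^sup>2 * rho t x * ?k \<le> (E t x)\<^sup>2 * N L t x"
        unfolding mult.assoc by (intro mult_left_mono) auto
    qed (intro ci; use t0 in auto)+
    moreover have "integral {-L..L} (\<lambda>x. (E t x)\<^sup>2 * rho t x * ?k) = mass 0 ^ 3 / 12 * ?k"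
      unfolding integral_mult_left by (simp add: integral_E_sq_rho[OF tc L] mass_conserved[OF t0])
    ultimately show ?thesis by linarith
  qed
  have "mass 0 ^ 3 / 12 * ?k * (T - 0) \<le> field_moment L T - field_moment L 0"
  proof (cases "T = 0")
    case False
    let ?g = "\<lambda>t. field_moment L t - mass 0 ^ 3 / 12 * ?k * t"
    have "?g 0 \<le> ?g T"
    proof (rule DERIV_nonneg_imp_increasing_open[OF T])
      fix t assume t: "0 < t" "t < T"
      show "\<exists>y. (?g has_real_derivative y) (at t) \<and> 0 \<le> y"
        using field_moment_dt[OF conf L, of t] lower[of t] t
        by (intro exI conjI derivative_eq_intros refl) (auto simp: at_within_Icc_at)
    next
      have "continuous_on {0..T} (field_moment L)"
        by (rule DERIV_continuous_on) (rule field_moment_dt[OF conf L])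
      then show "continuous_on {0..T} ?g" by (intro continuous_intros)
    qed
    then show ?thesis by simp
  qed simp
  then show ?thesis by simp
qed

text \<open>The field is at most half the mass, the weight at most \<open>q\<close> on the support,
  and the density integrates to the second factor of mass.\<close>

lemma abs_field_moment_le:
  assumes t: "t \<in> confined L" and L: "0 < L"
    and q: "\<And>x v1 v2. f t x (v1, v2) \<noteq> 0 \<Longrightarrow> \<bar>v1\<bar> \<le> q"
  shows "\<bar>field_moment L t\<bar> \<le> (mass t)\<^sup>2 / 2 * q"
proof -
  have t0: "0 \<le> t" using t by (rule confined_nonneg)
  have \<Phi>: "\<bar>\<Phi> L t x\<bar> \<le> q * rho t x" for x
  proof -
    have w: "\<bar>rel_weight v\<bar> \<le> q" if "f t x v \<noteq> 0" for v
      using q[of x "fst v" "snd v"] abs_rel_weight_le[of v] that by simp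
    have "\<Phi> L t x \<le> mom L (\<lambda>_. q * 1) t x"
      by (rule mom_mono) (use t0 w in \<open>auto intro: continuous_on_rel_weight dest: abs_le_D1\<close>)
    moreover have "mom L (\<lambda>_. - q * 1) t x \<le> \<Phi> L t x"
      by (rule mom_mono) (use t0 w in \<open>force intro: continuous_on_rel_weight dest: abs_le_D2\<close>)+
    ultimately show ?thesis unfolding mom_scale by (simp add: abs_le_iff rho_mom[OF t])
  qed
  note ci = integrable_continuous_real continuous_on_rel_weight continuous_intros mom_comp E_cont[OF t] rho_cont[OF t0]
  have "norm (field_moment L t) \<le> integral {-L..L} (\<lambda>x. mass t / 2 * q * rho t x)"
    unfolding field_moment_def
  proof (rule integral_norm_bound_integral)
    fix x assume x: "x \<in> {-L..L}"
    have "\<bar>E t x\<bar> * \<bar>\<Phi> L t x\<bar> \<le> mass t / 2 * (q * rho t x)"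
      using E_bound[OF t, of x] x \<Phi> mass_nonneg[OF t0] by (intro mult_mono) auto
    then show "norm (E t x * \<Phi> L t x) \<le> mass t / 2 * q * rho t x" by (simp add: abs_mult)
  qed (intro ci; use t0 in auto)+
  also have "\<dots> = (mass t)\<^sup>2 / 2 * q"
    by (simp add: mass_eq[OF t] power2_eq_square)
  finally show ?thesis by simp
qed

section \<open>Positivity of the mass and linear growth of the momentum support\<close>

text \<open>A continuous nonnegative function with zero integral vanishes; this is used for the
  density in \<open>x\<close>, then for \<open>f\<close> in \<open>v\<close>.\<close>

lemma mass_pos:
  assumes "f 0 x v \<noteq> 0"
  shows "0 < mass 0"
proof (rule ccontr)
  assume "\<not> 0 < mass 0"
  then have m0: "mass 0 = 0" using mass_nonneg[of 0] by simp
  obtain L where L: "0 \<in> confined L" "0 < L" by (rule confined_ex[of 0]) auto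
  have "f 0 x (fst v, snd v) \<noteq> 0" using assms by simp
  note cx = confinedD[OF L(1) this]
  have "\<forall>x\<in>cbox (-L) L. rho 0 x = 0"
    using integral_cbox_eq_0_iff[of "-L" L "rho 0"] mass_eq[OF L(1)] m0 rho_cont[of 0] rho_nonneg[of 0] L(2)
    by auto
  moreover have "x \<in> cbox (-L) L" using cx by auto
  ultimately have "rho 0 x = 0" by blast
  then have "integral (cbox (-L, -L) (L, L)) (\<lambda>v. 1 * f 0 x v) = 0"
    using rho_mom[OF L(1), of x] by (simp add: mom_def)
  moreover have "continuous_on (cbox (-L, -L) (L, L)) (\<lambda>v. 1 * f 0 x v)"
    by (intro f_comp continuous_intros) auto
  moreover have "box (-L, -L) (L, L) \<noteq> {}"
    using L(2) by (auto simp: box_ne_empty Basis_prod_def)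
  ultimately have "\<forall>v\<in>cbox (-L, -L) (L, L). 1 * f 0 x v = 0"
    by (subst (asm) integral_cbox_eq_0_iff) (auto simp: f_nonneg)
  moreover have "v \<in> cbox (-L, -L) (L, L)" using cx by (cases v) auto
  ultimately show False using assms by auto
qed


text \<open>Confinement bounds the set in \<open>Q1\<close>, so its \<open>Sup\<close> is a genuine
  supremum.\<close>

lemma le_Q1:
  assumes "0 \<le> t" "f t x (v1, v2) \<noteq> 0"
  shows "\<bar>v1\<bar> \<le> Q1 f t"
proof -
  obtain L where L: "t \<in> confined L" by (rule confined_ex[OF assms(1)])
  show ?thesis
    unfolding Q1_def
  proof (rule cSup_upper)
    show "bdd_above {\<bar>v1\<bar> | v1. \<exists>x v2. f t x (v1, v2) \<noteq> 0}"
      by (rule bdd_aboveI[of _ L]) (auto dest: confinedD[OF L])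
  qed (use assms(2) in blast)
qed

text \<open>Conservation of the positive mass keeps the support nonempty, without which
  \<open>Sup\<close> would carry no information.\<close>

lemma Q1_le:
  assumes "0 \<le> t" "0 < mass 0" "\<And>x v1 v2. f t x (v1, v2) \<noteq> 0 \<Longrightarrow> \<bar>v1\<bar> \<le> q"
  shows "Q1 f t \<le> q"
  unfolding Q1_def
proof (rule cSup_least)
  have "\<exists>x v. f t x v \<noteq> 0"
  proof (rule ccontr)
    assume "\<not> ?thesis"
    then have "f t x = (\<lambda>_. 0)" for x by auto
    then have "mass t = 0" by (simp add: mass_def rho_def[abs_def] charge_density_def)
    then show False using mass_conserved[OF assms(1)] assms(2) by simp
  qed
  then show "{\<bar>v1\<bar> | v1. \<exists>x v2. f t x (v1, v2) \<noteq> 0} \<noteq> {}" by auto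
qed (use assms(3) in blast)

lemma Q1_linear_growth:
  assumes ne: "f 0 x0 v0 \<noteq> 0"
  shows "\<exists>T C1 C2. T > 0 \<and> C1 > 0 \<and> C2 > 0 \<and> (\<forall>t\<ge>T. C1 * t \<le> Q1 f t \<and> Q1 f t \<le> C2 * t)"
proof -
  define M where "M = mass 0"
  have M: "0 < M" unfolding M_def by (rule mass_pos[OF ne])
  obtain r where r: "0 \<in> confined r" "0 < r" by (rule confined_ex[of 0]) auto
  define k where "k = M ^ 3 / (12 * sqrt (1 + r\<^sup>2))"
  have k: "0 < k" unfolding k_def using M by (simp add: add_pos_nonneg)
  have init: "\<bar>v1\<bar> \<le> r" "\<bar>v2\<bar> \<le> r" if "f 0 x (v1, v2) \<noteq> 0" for x v1 v2
    using confinedD[OF r(1) that] by auto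
  have upper: "Q1 f t \<le> r + M / 2 * t" if t: "0 \<le> t" for t
  proof (rule Q1_le[OF t])
    obtain L where L: "{0..t} \<subseteq> confined L" by (rule uniformly_confined)
    fix x v1 v2 assume "f t x (v1, v2) \<noteq> 0"
    from speed_bounds(2)[OF t L _ _ this, of 0 r] init(1) show "\<bar>v1\<bar> \<le> r + M / 2 * t"
      using t by (auto simp: M_def)
  qed (use M in \<open>simp add: M_def\<close>)
  \<comment> \<open>The growth of the field moment is compared with its size at times 0 and
    \<open>t\<close>. The cube size \<open>L\<close> depends on \<open>t\<close> but does not occur
    in the resulting inequality.\<close>
  have lower: "k * t \<le> M\<^sup>2 / 2 * (Q1 f t + Q1 f 0)" if t: "0 \<le> t" for t
  proof -
    obtain L where L: "0 < L" "{0..t} \<subseteq> confined L" by (rule uniformly_confined)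
    have "\<bar>field_moment L s\<bar> \<le> M\<^sup>2 / 2 * Q1 f s" if "s \<in> {0..t}" for s
      using abs_field_moment_le[of s L "Q1 f s"] le_Q1[of s] L that mass_conserved[of s]
      by (auto simp: M_def)
    then have "\<bar>field_moment L t\<bar> \<le> M\<^sup>2 / 2 * Q1 f t" "\<bar>field_moment L 0\<bar> \<le> M\<^sup>2 / 2 * Q1 f 0"
      using t by auto
    moreover have "k * t \<le> field_moment L t - field_moment L 0"
      unfolding k_def M_def by (rule field_moment_growth[OF L(2,1) t init(2)])
    ultimately show ?thesis by (simp add: distrib_left)
  qed
  \<comment> \<open>From \<open>T\<close> on, the initial term takes at most half of
    \<open>2 * (k * t)\<close> in the lower bound, and \<open>t \<ge> 1\<close> absorbs the constant
    \<open>r\<close> into the slope of the upper bound.\<close>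
  define T where "T = max 1 (Q1 f 0 * M\<^sup>2 / k)"
  have "k / M\<^sup>2 * t \<le> Q1 f t \<and> Q1 f t \<le> (r + M / 2) * t" if "T \<le> t" for t
  proof
    have t: "1 \<le> t" "Q1 f 0 * M\<^sup>2 / k \<le> t" using that by (auto simp: T_def)
    then have "Q1 f 0 * M\<^sup>2 \<le> k * t" using k by (simp add: pos_divide_le_eq mult.commute)
    moreover have "2 * (k * t) \<le> M\<^sup>2 * Q1 f t + Q1 f 0 * M\<^sup>2"
      using lower[of t] t by (simp add: field_simps)
    ultimately have "k * t \<le> M\<^sup>2 * Q1 f t" by linarith
    then show "k / M\<^sup>2 * t \<le> Q1 f t" using M by (simp add: pos_divide_le_eq mult.commute)
    have "r * 1 \<le> r * t" using t r(2) by (intro mult_left_mono) auto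
    then show "Q1 f t \<le> (r + M / 2) * t" using upper[of t] t by (simp add: distrib_right)
  qed
  then show ?thesis
    using M k r(2) by (intro exI[of _ T] exI[of _ "k / M\<^sup>2"] exI[of _ "r + M / 2"]) (auto simp: T_def)
qed

end

section \<open>Partial derivatives of a classical solution\<close>

lemma rvp_solution_imp_rvp:
  assumes "rvp_solution f"
  obtains ft fx fw where "rvp f ft fx fw"
proof -
  note sol = assms[unfolded rvp_solution_def]
  obtain g' :: "real \<times> real \<times> real \<times> real \<Rightarrow> (real \<times> real \<times> real \<times> real) \<Rightarrow>\<^sub>L real" where
    g': "\<And>z. z \<in> {0..} \<times> UNIV \<Longrightarrow>
      ((\<lambda>(t, x, v). f t x v) has_derivative blinfun_apply (g' z)) (at z within {0..} \<times> UNIV)"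
    and cont: "continuous_on ({0..} \<times> UNIV) g'"
    using conjunct1[OF sol] unfolding C1_on_def by blast
  have nonneg: "0 \<le> f t x v" and supp: "compactly_supported (\<lambda>(x, v). f t x v)" if "0 \<le> t" for t x v
    using sol that by (cases v; simp)+
  have pde: "vector_derivative (\<lambda>s. f s x (v1, v2)) (at t within {0..})
      + fst (rel_velocity (v1, v2)) * deriv (\<lambda>y. f t y (v1, v2)) x
      + electric_field f t x * deriv (\<lambda>w. f t x (w, v2)) v1 = 0" if "0 \<le> t" for t x v1 v2
    using sol that by simp
  define D where "D = (\<lambda>e t x v. blinfun_apply (g' (t, x, v)) e)"
  \<comment> \<open>The chain rule along a curve with velocity \<open>e\<close> at \<open>s\<close>;
    coordinate lines then give the partial derivatives, including the one-sided one in time.\<close>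
  have slice: "((\<lambda>s. (\<lambda>(t, x, v). f t x v) (\<gamma> s)) has_real_derivative blinfun_apply (g' (\<gamma> s)) e) (at s within S)"
    if "(\<gamma> has_derivative (\<lambda>h. h *\<^sub>R e)) (at s within S)" "\<gamma> ` S \<subseteq> {0..} \<times> UNIV" "s \<in> S" for \<gamma> :: "real \<Rightarrow> real \<times> real \<times> real \<times> real" and e s S
  proof -
    have "((\<lambda>s. (\<lambda>(t, x, v). f t x v) (\<gamma> s)) has_derivative (\<lambda>h. blinfun_apply (g' (\<gamma> s)) (h *\<^sub>R e))) (at s within S)"
      by (rule has_derivative_in_compose2[OF g' that(2,3,1)])
    then show ?thesis
      unfolding has_field_derivative_def blinfun.scaleR_right real_scaleR_def mult.commute[of _ "blinfun_apply _ _"] .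
  qed
  have dt: "((\<lambda>s. f s x v) has_real_derivative D (1, 0, 0) t x v) (at t within {0..})" if "0 \<le> t" for t x v
  proof -
    have "((\<lambda>s. (s, x, v)) has_derivative (\<lambda>h. h *\<^sub>R (1, 0, 0))) (at t within {0..})"
      unfolding scaleR_Pair scaleR_zero_right real_scaleR_def mult_1_right mult_zero_right
      by (intro has_derivative_Pair has_derivative_ident has_derivative_const)
    from slice[OF this] that show ?thesis by (simp add: D_def image_subset_iff)
  qed
  have dx: "((\<lambda>y. f t y v) has_real_derivative D (0, 1, 0) t x v) (at x)" if "0 \<le> t" for t x v
  proof -
    have "((\<lambda>y. (t, y, v)) has_derivative (\<lambda>h. h *\<^sub>R (0, 1, 0))) (at x within UNIV)"
      unfolding scaleR_Pair scaleR_zero_right real_scaleR_def mult_1_right mult_zero_right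
      by (intro has_derivative_Pair has_derivative_ident has_derivative_const)
    from slice[OF this] that show ?thesis by (simp add: D_def image_subset_iff)
  qed
  have dw: "((\<lambda>w. f t x (w, u)) has_real_derivative D (0, 0, 1, 0) t x (w, u)) (at w)" if "0 \<le> t" for t x w u
  proof -
    have "((\<lambda>w. (t, x, w, u)) has_derivative (\<lambda>h. h *\<^sub>R (0, 0, 1, 0))) (at w within UNIV)"
      unfolding scaleR_Pair scaleR_zero_right real_scaleR_def mult_1_right mult_zero_right
      by (intro has_derivative_Pair has_derivative_ident has_derivative_const)
    from slice[OF this] that show ?thesis by (simp add: D_def image_subset_iff)
  qed
  have Dcont: "continuous_on ({0..} \<times> UNIV) (\<lambda>(t, x, v). D e t x v)" for e
    unfolding D_def case_prod_unfold prod.collapse by (intro continuous_intros cont)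
  have "rvp f (D (1, 0, 0)) (D (0, 1, 0)) (D (0, 0, 1, 0))"
  proof
    show "continuous_on ({0..} \<times> UNIV) (\<lambda>(t, x, v). f t x v)"
      unfolding continuous_on_eq_continuous_within using g' has_derivative_continuous by blast
    show "D (1, 0, 0) t x v + fst (rel_velocity v) * D (0, 1, 0) t x v + electric_field f t x * D (0, 0, 1, 0) t x v = 0"
      if t: "0 \<le> t" for t x v
    proof -
      obtain v1 v2 where v: "v = (v1, v2)" by (cases v)
      \<comment> \<open>The half-line is connected and not a single point, so each of its points, 0
        included, is a limit point; hence the time derivative within it is unique.\<close>
      have "{0..} \<noteq> {s}" for s :: real
        by (metis atLeast_iff order_refl singletonD zero_le_one zero_neq_one)
      then have "at t within {0..} \<noteq> bot"
        using connected_imp_perfect[of "{0..}" t] t by (auto simp: trivial_limit_within)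
      then have "vector_derivative (\<lambda>s. f s x v) (at t within {0..}) = D (1, 0, 0) t x v"
        using dt[OF t] by (intro vector_derivative_within) (simp_all add: has_real_derivative_iff_has_vector_derivative)
      moreover have "deriv (\<lambda>y. f t y v) x = D (0, 1, 0) t x v" "deriv (\<lambda>w. f t x (w, v2)) v1 = D (0, 0, 1, 0) t x v"
        using dx[OF t] dw[OF t] by (auto simp: v intro!: DERIV_imp_deriv)
      ultimately show ?thesis
        using pde[OF t, of x v1 v2] unfolding v by simp
    qed
  qed (fact Dcont dt dx dw nonneg supp)+
  then show thesis by (rule that)
qed

theorem theorem1p3:
  fixes f0 :: "real \<Rightarrow> real \<times> real \<Rightarrow> real"
    and f :: "real \<Rightarrow> real \<Rightarrow> real \<times> real \<Rightarrow> real"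
  assumes "\<And>x v. f0 x v \<ge> 0"
    and "C1_on UNIV (\<lambda>(x, v). f0 x v)"
    and "compactly_supported (\<lambda>(x, v). f0 x v)"
    and "\<exists>x v. f0 x v \<noteq> 0"
    and "rvp_solution f"
    and "\<And>x v. f 0 x v = f0 x v"
  shows "\<exists>T C1 C2 :: real. T > 0 \<and> C1 > 0 \<and> C2 > 0 \<and>
           (\<forall>t\<ge>T. C1 * t \<le> Q1 f t \<and> Q1 f t \<le> C2 * t)"
proof -
  obtain ft fx fw where "rvp f ft fx fw"
    using rvp_solution_imp_rvp[OF assms(5)] .
  then interpret rvp f ft fx fw .
  obtain x v where "f 0 x v \<noteq> 0" using assms(4,6) by auto
  then show ?thesis by (rule Q1_linear_growth)
qed

end
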